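(* Let $a\ge 2$ be an integer and let $(v_n)_{n\ge 1}$ be a sequence of positive integers such that $v_{n+1}\ge 2v_n+2$. If $\xi$ is a Liouville number of the form $\xi=\sum_{n\ge 1}a^{-v_n}$, where $v_{n+1}/v_n$ tends to infinity as $n\to\infty$ (in particular, $\xi\in\mathcal{L}$), then $F(\xi)$ is a $U_m$-number, for any non-constant rational function $F(x)$ with coefficients in an $m$-degree number field.
   Context: For an algebraic number $\alpha$, the height $H(\alpha)$ is the maximum of the absolute values of the coefficients of the minimal polynomial of $\alpha$ over $\mathbb{Z}$. A real number $\xi$ is a Liouville number if there exist infinitely many rational numbers $(p_n/q_n)_n$, with $q_n>1$, such that $0<|\xi-p_n/q_n|<q_n^{-\omega_n}$ for some sequence of real numbers $(\omega_n)_n$ tending to $\infty$. The set $\mathcal{L}$ is the set of Liouville numbers $\xi$ for which there exist a sequence $(\omega_n)_n$ of positive real numbers tending to $\infty$ and an infinite sequence of rational numbers $(p_n/q_n)_n$ (taking infinitely many distinct values) satisfying $|\xi-p_n/q_n|<H(p_n/q_n)^{-\omega_n}$ and $H(p_{n+1}/q_{n+1})\le H(p_n/q_n)^{O(\omega_n)}$ for all $n\ge 1$, where $O(\omega_n)$ means at most $C\omega_n$ for a constant $C>0$ independent of $n$. For a number $\xi$ and an integer $n\ge 1$, $\omega_n^*(\xi)$ is the supremum of the positive real numbers $\omega^*$ for which there exist infinitely many real algebraic numbers $\alpha$ of degree $n$ satisfying $0<|\xi-\alpha|<H(\alpha)^{-\omega^*-1}$. The number $\xi$ is a $U_m$-number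 (equivalently, a $U_m^*$-number) if $\omega_m^*(\xi)=\infty$ and $\omega_n^*(\xi)<\infty$ for all $1\le n<m$.
   Formalization: The m-degree number field is taken to be real and to be exactly the field of the coefficients of F (F is defined over no proper subfield), since F(x)=x over Q(√2), or F(x)=ix over Q(i), makes the claim as worded false. *)

theory Defs
  imports
    Complex_Main
    "HOL-Library.Extended_Nonnegative_Real"
    "HOL-Computational_Algebra.Computational_Algebra"
    "HOL-Computational_Algebra.Field_as_Ring"
begin

subsection \<open>Minimal polynomials over the integers, degree and height\<close>

definition is_int_minpoly :: "int poly \<Rightarrow> real \<Rightarrow> bool" where
  "is_int_minpoly p \<alpha> \<longleftrightarrow>
     p \<noteq> 0 \<and> poly (map_poly of_int p) \<alpha> = 0 \<and> content p = 1 \<and> lead_coeff p > 0 \<and>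
     (\<forall>q. q \<noteq> 0 \<longrightarrow> poly (map_poly of_int q) \<alpha> = 0 \<longrightarrow> degree p \<le> degree q)"

lemma is_int_minpoly_unique:
  assumes p: "is_int_minpoly p \<alpha>" and q: "is_int_minpoly q \<alpha>"
  shows "p = q"
proof -
  have deg: "degree p = degree q"
    using p q unfolding is_int_minpoly_def by (meson order_antisym)
  define r where "r = smult (lead_coeff q) p - smult (lead_coeff p) q"
  have "r = 0"
  proof (rule ccontr)
    assume nz: "r \<noteq> 0"
    have lead_r: "coeff r (degree p) = 0" by (simp add: r_def deg)
    have "degree r \<le> degree p"
      unfolding r_def by (rule degree_diff_le) (use deg in \<open>simp_all add: degree_smult_le\<close>)
    moreover have "degree r \<noteq> degree p" using lead_r nz by (metis leading_coeff_0_iff)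
    ultimately have "degree r < degree p" by simp
    moreover have "map_poly of_int r =
        smult (of_int (lead_coeff q)) (map_poly of_int p) -
        smult (of_int (lead_coeff p)) (map_poly of_int q :: real poly)"
      by (rule poly_eqI) (simp add: r_def coeff_map_poly)
    hence "poly (map_poly of_int r) \<alpha> = 0" using p q by (simp add: is_int_minpoly_def)
    hence "degree p \<le> degree r" using p nz by (simp add: is_int_minpoly_def)
    ultimately show False by simp
  qed
  hence eq: "smult (lead_coeff q) p = smult (lead_coeff p) q" by (simp add: r_def)
  have "content (smult (lead_coeff q) p) = content (smult (lead_coeff p) q)" using eq by simp
  hence "lead_coeff q = lead_coeff p" using p q by (simp add: is_int_minpoly_def)
  with eq have "smult (lead_coeff p) (p - q) = 0" by (simp add: smult_diff_right)
  moreover have "lead_coeff p \<noteq> 0" using p by (simp add: is_int_minpoly_def)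
  ultimately have "p - q = 0" using smult_eq_0_iff by blast
  thus "p = q" by simp
qed

lemma is_int_minpoly_exists:
  assumes "algebraic \<alpha>"
  shows "\<exists>p. is_int_minpoly p \<alpha>"
proof -
  define R where "R q \<longleftrightarrow> q \<noteq> 0 \<and> poly (map_poly of_int q) \<alpha> = 0" for q :: "int poly"
  obtain p0 where p0: "\<And>i. coeff p0 i \<in> \<int>" "p0 \<noteq> 0" "poly p0 \<alpha> = 0"
    using assms unfolding algebraic_def by blast
  define q0 :: "int poly" where "q0 = map_poly floor p0"
  have "map_poly of_int q0 = p0"
    using p0(1) by (intro poly_eqI) (simp add: q0_def coeff_map_poly)
  with p0 have "R q0" unfolding R_def by (metis map_poly_0)
  then obtain q where q: "R q" "\<And>q'. R q' \<Longrightarrow> degree q \<le> degree q'"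
    using ex_has_least_nat[of R q0 degree] by blast
  define s where "s = content q * sgn (lead_coeff q)"
  define p where "p = smult (sgn (lead_coeff q)) (primitive_part q)"
  have qnz: "q \<noteq> 0" using q(1) by (simp add: R_def)
  have snz: "s \<noteq> 0" using qnz by (simp add: s_def sgn_if)
  have qp: "q = smult s p"
    using qnz by (simp add: s_def p_def sgn_if)
  have "map_poly of_int q = smult (of_int s) (map_poly of_int p :: real poly)"
    unfolding qp by (rule poly_eqI) (simp add: coeff_map_poly)
  hence root: "poly (map_poly of_int p) \<alpha> = 0" using q(1) snz by (simp add: R_def)
  have degp: "degree p = degree q" using qp snz by simp
  have cont: "content p = 1"
    using qnz by (simp add: p_def sgn_if)
  have lead: "lead_coeff p > 0"
  proof -
    have "content q > 0"
      using qnz normalize_content[of q] by (metis abs_of_neg content_eq_zero_iff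
          linorder_neqE_linordered_idom neg_less_0_iff_less normalize_int_def not_less_iff_gr_or_eq)
    moreover have lq: "lead_coeff q \<noteq> 0" using qnz by simp
    have "lead_coeff q = s * lead_coeff p" by (simp add: qp)
    hence "sgn (lead_coeff q) * lead_coeff q
        = sgn (lead_coeff q) * sgn (lead_coeff q) * (content q * lead_coeff p)"
      by (metis s_def mult.assoc mult.commute)
    moreover have "sgn (lead_coeff q) * sgn (lead_coeff q) = 1"
      using lq unfolding sgn_if by simp
    moreover have "sgn (lead_coeff q) * lead_coeff q > 0"
      using lq by (metis abs_sgn mult.commute zero_less_abs_iff)
    ultimately have "content q * lead_coeff p > 0" by (metis mult_1)
    thus ?thesis using \<open>content q > 0\<close> by (metis zero_less_mult_pos)
  qed
  have "is_int_minpoly p \<alpha>"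
    unfolding is_int_minpoly_def using root degp cont lead q(2) by (auto simp: R_def)
  thus ?thesis ..
qed

definition int_minpoly :: "real \<Rightarrow> int poly" where
  "int_minpoly \<alpha> = (THE p. is_int_minpoly p \<alpha>)"

lemma int_minpoly:
  assumes "algebraic \<alpha>"
  shows "is_int_minpoly (int_minpoly \<alpha>) \<alpha>"
  unfolding int_minpoly_def
  using is_int_minpoly_exists[OF assms] is_int_minpoly_unique by (metis theI)

definition alg_degree :: "real \<Rightarrow> nat" where
  "alg_degree \<alpha> = degree (int_minpoly \<alpha>)"

definition height :: "real \<Rightarrow> int" where
  "height \<alpha> = Max {\<bar>coeff (int_minpoly \<alpha>) i\<bar> | i. i \<le> degree (int_minpoly \<alpha>)}"


subsection \<open>Liouville numbers and U-numbers\<close>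

definition liouville_number :: "real \<Rightarrow> bool" where
  "liouville_number \<xi> \<longleftrightarrow>
     (\<exists>(p :: nat \<Rightarrow> int) (q :: nat \<Rightarrow> int) (\<omega> :: nat \<Rightarrow> real).
        infinite (range (\<lambda>n. of_int (p n) / of_int (q n) :: real)) \<and>
        filterlim \<omega> at_top sequentially \<and>
        (\<forall>n. q n > 1 \<and>
             0 < \<bar>\<xi> - of_int (p n) / of_int (q n)\<bar> \<and>
             \<bar>\<xi> - of_int (p n) / of_int (q n)\<bar> < of_int (q n) powr (- \<omega> n)))"

definition liouville_class :: "real set"  (\<open>\<L>\<close>) where
  "\<L> = {\<xi>. liouville_number \<xi> \<and>
     (\<exists>(\<omega> :: nat \<Rightarrow> real) (r :: nat \<Rightarrow> rat) C.
        (\<forall>n. \<omega> n > 0) \<and> filterlim \<omega> at_top sequentially \<and> infinite (range r) \<and> C > 0 \<and>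
        (\<forall>n. \<bar>\<xi> - of_rat (r n)\<bar> < of_int (height (of_rat (r n))) powr (- \<omega> n) \<and>
             (of_int (height (of_rat (r (Suc n)))) :: real)
               \<le> of_int (height (of_rat (r n))) powr (C * \<omega> n)))}"

text \<open>The supremum is taken in \<^typ>\<open>ennreal\<close>, so it is \<open>0\<close> if no exponent is admissible.\<close>

definition omega_star :: "nat \<Rightarrow> real \<Rightarrow> ennreal" where
  "omega_star n \<xi> = Sup (ennreal ` {w. w > 0 \<and>
     infinite {\<alpha> :: real. algebraic \<alpha> \<and> alg_degree \<alpha> = n \<and>
       0 < \<bar>\<xi> - \<alpha>\<bar> \<and> \<bar>\<xi> - \<alpha>\<bar> < of_int (height \<alpha>) powr (- w - 1)}})"

definition U_number :: "nat \<Rightarrow> real \<Rightarrow> bool" where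
  "U_number m \<xi> \<longleftrightarrow> m \<ge> 1 \<and> omega_star m \<xi> = \<infinity> \<and> (\<forall>n. 1 \<le> n \<and> n < m \<longrightarrow> omega_star n \<xi> < \<infinity>)"


subsection \<open>Real number fields\<close>

definition is_subfield :: "real set \<Rightarrow> bool" where
  "is_subfield K \<longleftrightarrow> 0 \<in> K \<and> 1 \<in> K \<and>
     (\<forall>x\<in>K. \<forall>y\<in>K. x - y \<in> K \<and> x * y \<in> K) \<and> (\<forall>x\<in>K. inverse x \<in> K)"

definition rat_scale :: "rat \<Rightarrow> real \<Rightarrow> real" where
  "rat_scale q x = of_rat q * x"

lemma vector_space_rat_scale: "vector_space rat_scale"
  by unfold_locales (simp_all add: rat_scale_def algebra_simps of_rat_add of_rat_mult)

definition number_field :: "real set \<Rightarrow> bool" where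
  "number_field K \<longleftrightarrow> is_subfield K \<and> (\<exists>B. finite B \<and> module.span rat_scale B = K)"

definition field_degree :: "real set \<Rightarrow> nat" where
  "field_degree K = vector_space.dim rat_scale K"


subsection \<open>Rational functions\<close>

text \<open>
  \<^const>\<open>quot_of_fract\<close> returns the coprime pair of numerator and monic denominator.
\<close>

definition ratfun_eval :: "real poly fract \<Rightarrow> real \<Rightarrow> real" where
  "ratfun_eval F x = poly (fst (quot_of_fract F)) x / poly (snd (quot_of_fract F)) x"

lemma ratfun_eval_Fract:
  assumes "poly Q x \<noteq> 0"
  shows "ratfun_eval (Fract P Q) x = poly P x / poly Q x"
proof -
  obtain n d where nd: "quot_of_fract (Fract P Q) = (n, d)" by fastforce
  have norm: "(n, d) \<in> normalized_fracts" using quot_of_fract_in_normalized_fracts nd by metis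
  hence cop: "coprime n d" by (simp add: normalized_fracts_def)
  have dnz: "d \<noteq> 0" using norm by auto
  have Qnz: "Q \<noteq> 0" using assms by auto
  have "quot_to_fract (n, d) = Fract P Q"
    using nd quot_to_fract_quot_of_fract by metis
  hence "Fract n d = Fract P Q" by (simp add: quot_to_fract_def)
  hence eq: "n * Q = P * d" using dnz Qnz by (simp add: eq_fract)
  hence eqx: "poly n x * poly Q x = poly P x * poly d x" by (metis poly_mult)
  have "poly d x \<noteq> 0"
  proof
    assume d0: "poly d x = 0"
    hence "poly n x = 0" using eqx assms by simp
    hence "is_unit [:-x, 1:]" using d0 cop by (meson coprime_common_divisor poly_eq_0_iff_dvd)
    thus False by (simp add: is_unit_poly_iff)
  qed
  thus ?thesis using eqx assms by (simp add: ratfun_eval_def nd field_simps)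
qed

definition constant_ratfun :: "real poly fract \<Rightarrow> bool" where
  "constant_ratfun F \<longleftrightarrow> (\<exists>c. F = Fract [:c:] 1)"

definition ratfun_over :: "real set \<Rightarrow> real poly fract \<Rightarrow> bool" where
  "ratfun_over K F \<longleftrightarrow>
     (\<exists>P Q. Q \<noteq> 0 \<and> set (coeffs P) \<subseteq> K \<and> set (coeffs Q) \<subseteq> K \<and> F = Fract P Q)"

text \<open>
  \<open>K\<close> is the field of the coefficients of \<open>F\<close>: \<open>F \<in> K(x)\<close>, but \<open>F \<notin> L(x)\<close> for every proper
  subfield \<open>L\<close> of \<open>K\<close>.  The minimality cannot be dropped when \<open>K\<close> is required to have degree
  exactly \<open>m\<close>: \<open>F = x\<close> lies in \<open>K(x)\<close> for every \<open>K\<close>.  It is imposed on \<open>F\<close> rather than on a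
  particular numerator and denominator, since these may share a factor from \<open>K\<close>.
\<close>

definition coefficient_field :: "real set \<Rightarrow> real poly fract \<Rightarrow> bool" where
  "coefficient_field K F \<longleftrightarrow> ratfun_over K F \<and>
     (\<forall>L. is_subfield L \<and> L \<subseteq> K \<and> ratfun_over L F \<longrightarrow> L = K)"

end

theory Submission
  imports Defs "Jordan_Normal_Form.Char_Poly"
begin

text \<open>
  The partial sums \<open>r\<^sub>k = p\<^sub>k / q\<^sub>k\<close>, \<open>q\<^sub>k = a ^ v\<^sub>k\<close>, approximate \<open>\<xi>\<close> to within \<open>2 / q\<^sub>k\<^sub>+\<^sub>1\<close>, and
  \<open>q\<^sub>k\<^sub>+\<^sub>1\<close> eventually exceeds every fixed power of \<open>q\<^sub>k\<close>.  Elements of \<open>K\<close> act on a basis of \<open>K\<close>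
  by rational matrices; determinants of such matrices provide both an integral relation
  \<open>T(x, F(x)) = 0\<close> of degree at most \<open>m\<close> in the second variable, hence
  \<open>H(F(r\<^sub>k)) \<le> C q\<^sub>k ^ D\<close>, and a Liouville inequality.

  For almost all rational \<open>r\<close> the value \<open>F(r)\<close> has degree exactly \<open>m\<close>: if \<open>T\<close> has minimal degree,
  then it is separable at \<open>(r, F(r))\<close> for almost all \<open>r\<close>, so all Taylor coefficients of \<open>F\<close> at \<open>r\<close> lie
  in \<open>L = \<rat>(F(r))\<close>; then \<open>F \<in> L(x)\<close> by linear algebra, and \<open>L = K\<close>.  Hence the
  \<open>F(r\<^sub>k)\<close> show that \<open>\<omega>\<^sub>m\<^sup>*(F(\<xi>)) = \<infinity>\<close>.  A number \<open>\<gamma>\<close> of smaller degree differs from \<open>F(r\<^sub>k)\<close>, and comparing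
  it with \<open>F(r\<^sub>k)\<close> for the first \<open>k\<close> with \<open>q\<^sub>k\<^sub>+\<^sub>1\<close> larger than a certain power of \<open>H(\<gamma>)\<close> gives
  \<open>\<bar>F(\<xi>) - \<gamma>\<bar> \<ge> c H(\<gamma>) ^ (- M)\<close>.
\<close>

subsection \<open>Number fields and integral matrices\<close>

text \<open>\<open>K\<close> is a set of real numbers, so the conjugates of its elements, in general
  complex, are not at hand; integral matrices stand in for them. The determinant replaces the norm,
  and a bound on the entries replaces a bound on all conjugates. Likewise the usual proof that F(r)
  generates \<open>K\<close> for almost all r compares F with its conjugate functions; here the
  Taylor coefficients of F at r take their place, since they lie in the field of F(r) and determine
  a field over which F is defined.

  A number \<gamma> of degree n < m may lie outside \<open>K\<close>, so the difference of F(r) and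
  \<gamma> is not accessible to the matrices. Instead the integral minimal polynomial g of \<gamma>
  is evaluated at F(r): g(F(r)) is an element of \<open>K\<close>, nonzero because F(r) has degree
  m, and bounded by a constant times H(\<gamma>) times the distance of F(r) and \<gamma>.\<close>

lemma abs_det_le:
  fixes A :: "int mat"
  assumes A: "A \<in> carrier_mat n n"
    and B: "\<And>i j. i < n \<Longrightarrow> j < n \<Longrightarrow> real_of_int \<bar>A $$ (i,j)\<bar> \<le> B"
  shows "real_of_int \<bar>det A\<bar> \<le> fact n * B ^ n"
proof -
  have "real_of_int \<bar>det A\<bar> \<le>
      (\<Sum>p | p permutes {0..<n}. \<bar>real_of_int (of_int (sign p) * (\<Prod>i = 0..<n. A $$ (i, p i)))\<bar>)"
    unfolding det_def'[OF A] of_int_abs of_int_sum by (rule sum_abs)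
  also have "\<dots> \<le> (\<Sum>p | p permutes {0..<n}. B ^ n)"
  proof (rule sum_mono)
    fix p assume "p \<in> {p. p permutes {0..<n}}"
    hence p: "p permutes {0..<n}" by simp
    have "\<bar>real_of_int (of_int (sign p) * (\<Prod>i = 0..<n. A $$ (i, p i)))\<bar>
        = (\<Prod>i = 0..<n. real_of_int \<bar>A $$ (i, p i)\<bar>)"
      by (simp add: abs_mult abs_prod sign_def)
    also have "\<dots> \<le> (\<Prod>i = 0..<n. B)"
      using p B by (intro prod_mono) (auto simp: permutes_in_image)
    finally show "\<bar>real_of_int (of_int (sign p) * (\<Prod>i = 0..<n. A $$ (i, p i)))\<bar> \<le> B ^ n" by simp
  qed
  also have "\<dots> = fact n * B ^ n"
    by (simp add: card_permutations)
  finally show ?thesis .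
qed

lemma det_eq_0_if_kernel:
  fixes M :: "nat \<Rightarrow> nat \<Rightarrow> 'a::idom"
  assumes "\<And>j. j < n \<Longrightarrow> (\<Sum>k<n. M j k * b k) = 0" and "i < n" "b i \<noteq> 0"
  shows "det (mat n n (\<lambda>(j,k). M j k)) = 0"
proof -
  let ?v = "vec n b"
  have "?v \<in> carrier_vec n" by simp
  moreover have "?v \<noteq> 0\<^sub>v n" using assms(2,3) by (metis index_vec index_zero_vec(1))
  moreover have "mat n n (\<lambda>(j,k). M j k) *\<^sub>v ?v = 0\<^sub>v n"
    using assms(1) by (intro eq_vecI) (auto simp: scalar_prod_def atLeast0LessThan)
  ultimately show ?thesis
    using det_0_iff_vec_prod_zero[of "mat n n (\<lambda>(j,k). M j k)" n] mat_carrier by blast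
qed

lemma common_denominator:
  fixes S :: "rat set"
  assumes "finite S"
  shows "\<exists>N::int. N > 0 \<and> (\<forall>q\<in>S. of_int N * q \<in> \<int>)"
  using assms
proof induction
  case empty
  show ?case by (intro exI[of _ 1]) simp
next
  case (insert q S)
  then obtain N :: int where N: "N > 0" "\<forall>q\<in>S. of_int N * q \<in> \<int>" by auto
  obtain x y where xy: "q = of_int x / of_int y" "y > 0"
    using quotient_of_div quotient_of_denom_pos' by (metis prod.collapse)
  have "of_int (N * y) * q = of_int (N * x)"
    using xy by simp
  moreover have "of_int (N * y) * q' \<in> \<int>" if "q' \<in> S" for q'
  proof -
    have "of_int (N * y) * q' = of_int y * (of_int N * q')" by simp
    thus ?thesis using N(2) that by (metis Ints_mult Ints_of_int)
  qed
  ultimately show ?case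
    using N(1) xy(2) Ints_of_int by (intro exI[of _ "N * y"] conjI ballI) (auto simp del: of_int_mult)
qed

section \<open>Multiplication matrices with respect to a rational basis\<close>

locale number_basis =
  fixes m :: nat and b :: "nat \<Rightarrow> real" and K :: "real set"
  assumes subfield: "is_subfield K"
    and indep: "(\<Sum>i<m. of_rat (c i) * b i) = 0 \<Longrightarrow> i < m \<Longrightarrow> c i = 0"
    and in_K: "z \<in> K \<longleftrightarrow> (\<exists>c. z = (\<Sum>i<m. of_rat (c i) * b i))"
begin

lemma m_pos: "m > 0"
proof (rule ccontr)
  assume "\<not> m > 0"
  hence "1 \<notin> K" using in_K by auto
  thus False using subfield by (simp add: is_subfield_def)
qed

lemma b_nonzero: assumes "i < m" shows "b i \<noteq> 0"
proof
  assume "b i = 0"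
  hence "(\<Sum>j<m. of_rat ((\<lambda>j. if j = i then 1 else 0) j) * b j) = 0"
    by (intro sum.neutral) simp
  from indep[OF this assms] show False by simp
qed

lemma b_in_K: assumes "i < m" shows "b i \<in> K"
proof -
  have "b i = (\<Sum>j<m. of_rat (if j = i then 1 else 0) * b j)"
    using assms by (simp add: if_distrib[of of_rat] if_distrib[of "\<lambda>x. x * _"] cong: if_cong)
  thus ?thesis
    unfolding in_K by (intro exI[of _ "\<lambda>j. if j = i then 1 else 0"])
qed

text \<open>\<open>b\<close> is an eigenvector of \<open>M\<close> with eigenvalue \<open>z\<close>.
  Real entries are allowed, so that a matrix of polynomials can be evaluated at any real point, even
  outside \<open>K\<close>; integrality is added where the determinant has to be nonzero.\<close>

definition acts :: "(nat \<Rightarrow> nat \<Rightarrow> real) \<Rightarrow> real \<Rightarrow> bool" where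
  "acts M z \<longleftrightarrow> (\<forall>j<m. (\<Sum>k<m. M j k * b k) = z * b j)"

lemma acts_add: "acts M z \<Longrightarrow> acts N w \<Longrightarrow> acts (\<lambda>j k. M j k + N j k) (z + w)"
  by (simp add: acts_def algebra_simps sum.distrib)

lemma acts_diff: "acts M z \<Longrightarrow> acts N w \<Longrightarrow> acts (\<lambda>j k. M j k - N j k) (z - w)"
  by (simp add: acts_def algebra_simps sum_subtractf)

lemma acts_scale: "acts M z \<Longrightarrow> acts (\<lambda>j k. c * M j k) (c * z)"
  by (simp add: acts_def mult.assoc flip: sum_distrib_left)

lemma acts_zero: "acts (\<lambda>j k. 0) 0"
  by (simp add: acts_def)

lemma acts_one: "acts (\<lambda>j k. of_bool (j = k)) 1"
  by (simp add: acts_def of_bool_def if_distrib[of "\<lambda>x. x * _"] cong: if_cong)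

lemma acts_mult:
  assumes "acts M z" "acts N w"
  shows "acts (\<lambda>j k. \<Sum>l<m. M j l * N l k) (z * w)"
  unfolding acts_def
proof (intro allI impI)
  fix j assume j: "j < m"
  have "(\<Sum>k<m. (\<Sum>l<m. M j l * N l k) * b k) = (\<Sum>k<m. \<Sum>l<m. M j l * (N l k * b k))"
    by (simp add: sum_distrib_right mult.assoc)
  also have "\<dots> = (\<Sum>l<m. M j l * (\<Sum>k<m. N l k * b k))"
    by (subst sum.swap) (simp add: sum_distrib_left)
  also have "\<dots> = (\<Sum>l<m. w * (M j l * b l))"
    using assms(2) by (intro sum.cong) (auto simp: acts_def)
  also have "\<dots> = z * w * b j"
    using assms(1) j by (simp add: acts_def flip: sum_distrib_left)
  finally show "(\<Sum>k<m. (\<Sum>l<m. M j l * N l k) * b k) = z * w * b j" .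
qed

lemma det_eq_0: "acts M 0 \<Longrightarrow> det (mat m m (\<lambda>(j,k). M j k)) = 0"
  using m_pos b_nonzero by (intro det_eq_0_if_kernel[of m M b 0]) (auto simp: acts_def)

text \<open>A singular integral matrix has a nonzero integral left null vector \<open>u\<close>.
  Pairing it with the eigenvector \<open>b\<close> shows that \<open>z\<close> times the
  corresponding combination of the basis vanishes, a rational dependence. For real entries an
  eigenvector with nonzero eigenvalue would not exclude a kernel.\<close>

lemma det_nonzero:
  fixes A :: "nat \<Rightarrow> nat \<Rightarrow> int"
  assumes acts: "acts (\<lambda>j k. of_int (A j k)) z" and z: "z \<noteq> 0"
  shows "det (mat m m (\<lambda>(j,k). A j k)) \<noteq> 0"
proof
  let ?M = "mat m m (\<lambda>(j,k). A j k)"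
  assume "det ?M = 0"
  hence "det (?M\<^sup>T) = 0" by (subst det_transpose[of _ m]) auto
  then obtain u where u: "u \<in> carrier_vec m" "u \<noteq> 0\<^sub>v m" "?M\<^sup>T *\<^sub>v u = 0\<^sub>v m"
    using det_0_iff_vec_prod_zero[of "?M\<^sup>T" m] by auto
  have col: "(\<Sum>j<m. A j k * vec_index u j) = 0" if "k < m" for k
  proof -
    have "vec_index (?M\<^sup>T *\<^sub>v u) k = 0" using u(3) that by simp
    thus ?thesis using that u(1) by (auto simp: scalar_prod_def atLeast0LessThan)
  qed
  have "z * (\<Sum>j<m. of_int (vec_index u j) * b j) = (\<Sum>j<m. of_int (vec_index u j) * (\<Sum>k<m. of_int (A j k) * b k))"
    using acts by (simp add: acts_def sum_distrib_left mult.left_commute)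
  also have "\<dots> = (\<Sum>k<m. \<Sum>j<m. of_int (vec_index u j) * (of_int (A j k) * b k))"
    unfolding sum_distrib_left by (rule sum.swap)
  also have "\<dots> = (\<Sum>k<m. of_int (\<Sum>j<m. A j k * vec_index u j) * b k)"
    by (simp add: sum_distrib_left sum_distrib_right algebra_simps)
  also have "\<dots> = 0" using col by (intro sum.neutral) simp
  finally have "(\<Sum>j<m. of_rat (of_int (vec_index u j)) * b j) = 0" using z by simp
  hence "vec_index u j = 0" if "j < m" for j
    using indep[of "\<lambda>j. of_int (vec_index u j)" j] that by simp
  hence "u = 0\<^sub>v m" using u(1) by auto
  thus False using u(2) by simp
qed

text \<open>Such a \<open>z\<close> is an algebraic integer, and \<open>B\<close> controls all its
  conjugates at once: they are eigenvalues of the matrix, hence at most \<open>real m * B\<close> in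
  absolute value.\<close>

definition rep :: "real \<Rightarrow> real \<Rightarrow> bool" where
  "rep z B \<longleftrightarrow> (\<exists>A :: nat \<Rightarrow> nat \<Rightarrow> int. acts (\<lambda>j k. of_int (A j k)) z \<and>
     (\<forall>j<m. \<forall>k<m. real_of_int \<bar>A j k\<bar> \<le> B))"

lemma rep_nonneg: "rep z B \<Longrightarrow> B \<ge> 0"
  using m_pos unfolding rep_def by force

lemma rep_mono: "rep z B \<Longrightarrow> B \<le> B' \<Longrightarrow> rep z B'"
  unfolding rep_def by fastforce

lemma rep_zero: "rep 0 0"
  unfolding rep_def using acts_zero by (intro exI[of _ "\<lambda>j k. 0"]) simp

lemma rep_one: "rep 1 1"
  unfolding rep_def using acts_one by (intro exI[of _ "\<lambda>j k. of_bool (j = k)"]) simp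

lemma rep_add:
  assumes "rep z B" "rep w C"
  shows "rep (z + w) (B + C)"
proof -
  obtain M N :: "nat \<Rightarrow> nat \<Rightarrow> int" where MN:
    "acts (\<lambda>j k. of_int (M j k)) z" "\<forall>j<m. \<forall>k<m. real_of_int \<bar>M j k\<bar> \<le> B"
    "acts (\<lambda>j k. of_int (N j k)) w" "\<forall>j<m. \<forall>k<m. real_of_int \<bar>N j k\<bar> \<le> C"
    using assms unfolding rep_def by blast
  show ?thesis unfolding rep_def
  proof (intro exI[of _ "\<lambda>j k. M j k + N j k"] conjI allI impI)
    show "acts (\<lambda>j k. of_int (M j k + N j k)) (z + w)"
      using acts_add[OF MN(1,3)] by simp
    fix j k assume "j < m" "k < m"
    hence "real_of_int \<bar>M j k\<bar> + real_of_int \<bar>N j k\<bar> \<le> B + C"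
      using MN by (intro add_mono) auto
    thus "real_of_int \<bar>M j k + N j k\<bar> \<le> B + C" by linarith
  qed
qed

lemma rep_scale:
  assumes "rep z B"
  shows "rep (of_int c * z) (of_int \<bar>c\<bar> * B)"
proof -
  obtain M :: "nat \<Rightarrow> nat \<Rightarrow> int" where M:
    "acts (\<lambda>j k. of_int (M j k)) z" "\<forall>j<m. \<forall>k<m. real_of_int \<bar>M j k\<bar> \<le> B"
    using assms unfolding rep_def by blast
  show ?thesis unfolding rep_def
  proof (intro exI[of _ "\<lambda>j k. c * M j k"] conjI allI impI)
    show "acts (\<lambda>j k. of_int (c * M j k)) (of_int c * z)"
      using acts_scale[OF M(1), of "of_int c"] by simp
    fix j k assume "j < m" "k < m"
    thus "real_of_int \<bar>c * M j k\<bar> \<le> of_int \<bar>c\<bar> * B"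
      using M(2) by (simp add: abs_mult mult_left_mono)
  qed
qed

lemma rep_sum:
  assumes "\<And>i. i \<in> I \<Longrightarrow> rep (z i) (B i)"
  shows "rep (\<Sum>i\<in>I. z i) (\<Sum>i\<in>I. B i)"
  using assms
  by (induction I rule: infinite_finite_induct) (simp_all add: rep_zero rep_add)

lemma rep_mult:
  assumes "rep z B" "rep w C"
  shows "rep (z * w) (real m * B * C)"
proof -
  obtain M N :: "nat \<Rightarrow> nat \<Rightarrow> int" where MN:
    "acts (\<lambda>j k. of_int (M j k)) z" "\<forall>j<m. \<forall>k<m. real_of_int \<bar>M j k\<bar> \<le> B"
    "acts (\<lambda>j k. of_int (N j k)) w" "\<forall>j<m. \<forall>k<m. real_of_int \<bar>N j k\<bar> \<le> C"
    using assms unfolding rep_def by blast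
  show ?thesis unfolding rep_def
  proof (intro exI[of _ "\<lambda>j k. \<Sum>l<m. M j l * N l k"] conjI allI impI)
    show "acts (\<lambda>j k. of_int (\<Sum>l<m. M j l * N l k)) (z * w)"
      using acts_mult[OF MN(1,3)] by simp
    fix j k assume jk: "j < m" "k < m"
    have "real_of_int \<bar>\<Sum>l<m. M j l * N l k\<bar> \<le> (\<Sum>l<m. real_of_int \<bar>M j l\<bar> * real_of_int \<bar>N l k\<bar>)"
      using sum_abs[of "\<lambda>l. real_of_int (M j l * N l k)" "{..<m}"] by (simp add: abs_mult)
    also have "\<dots> \<le> (\<Sum>l<m. B * C)"
      using MN jk rep_nonneg[OF assms(1)] by (intro sum_mono mult_mono) auto
    finally show "real_of_int \<bar>\<Sum>l<m. M j l * N l k\<bar> \<le> real m * B * C" by simp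
  qed
qed

lemma rep_power:
  assumes "rep z B"
  shows "rep (z ^ n) ((real m * B) ^ n)"
proof (induction n)
  case 0
  show ?case using rep_one by simp
next
  case (Suc n)
  show ?case using rep_mult[OF assms Suc] by simp
qed

text \<open>The adjugate of an integral matrix acting as \<open>z\<close> maps the eigenvector \<open>b\<close> to
  \<open>det / z\<close> times \<open>b\<close>, and the determinant is a nonzero integer.\<close>

lemma rep_lower_bound:
  obtains \<kappa> where "\<kappa> > 0" "\<And>z B. rep z B \<Longrightarrow> z \<noteq> 0 \<Longrightarrow> 1 \<le> \<kappa> * \<bar>z\<bar> * B ^ (m - 1)"
proof -
  \<comment> \<open>Row 0 of \<open>adj_mat M * M\<close> is applied to \<open>b\<close>: the
    entries of the adjugate are minors of order \<open>m - 1\<close>, whence the factorial, and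
    dividing by \<open>b 0\<close> normalises.\<close>
  define \<kappa> where "\<kappa> = fact (m - 1) * (\<Sum>j<m. \<bar>b j\<bar>) / \<bar>b 0\<bar>"
  have b0: "b 0 \<noteq> 0" using b_nonzero m_pos by simp
  have "\<bar>b 0\<bar> \<le> (\<Sum>j<m. \<bar>b j\<bar>)"
    using m_pos member_le_sum[of 0 "{..<m}" "\<lambda>j. \<bar>b j\<bar>"] by simp
  hence "\<kappa> > 0" using b0 by (simp add: \<kappa>_def)
  moreover have "1 \<le> \<kappa> * \<bar>z\<bar> * B ^ (m - 1)" if rep: "rep z B" and z: "z \<noteq> 0" for z B
  proof -
    obtain A :: "nat \<Rightarrow> nat \<Rightarrow> int" where A:
      "acts (\<lambda>j k. of_int (A j k)) z" "\<forall>j<m. \<forall>k<m. real_of_int \<bar>A j k\<bar> \<le> B"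
      using rep unfolding rep_def by blast
    define M where "M = mat m m (\<lambda>(j,k). A j k)"
    have M: "M \<in> carrier_mat m m" by (simp add: M_def)
    have adj: "adj_mat M \<in> carrier_mat m m" using adj_mat(1)[OF M] .
    have "det M \<noteq> 0" using det_nonzero[OF A(1) z] by (simp add: M_def)
    hence det1: "real_of_int \<bar>det M\<bar> \<ge> 1" by linarith
    have ent: "(\<Sum>j<m. adj_mat M $$ (0,j) * A j k) = det M * of_bool (k = 0)" if "k < m" for k
    proof -
      have "(adj_mat M * M) $$ (0,k) = (det M \<cdot>\<^sub>m 1\<^sub>m m) $$ (0,k)" using adj_mat(3)[OF M] by simp
      thus ?thesis using that m_pos adj M
        by (auto simp: scalar_prod_def atLeast0LessThan M_def)
    qed
    have "of_int (det M) * b 0 = (\<Sum>k<m. of_int (det M * of_bool (k = 0)) * b k)"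
      using m_pos by (simp add: of_bool_def if_distrib[of of_int] if_distrib[of "\<lambda>x. _ * x"]
          if_distrib[of "\<lambda>x. x * _"] cong: if_cong)
    also have "\<dots> = (\<Sum>k<m. of_int (\<Sum>j<m. adj_mat M $$ (0,j) * A j k) * b k)"
      using ent by (intro sum.cong) simp_all
    also have "\<dots> = (\<Sum>k<m. \<Sum>j<m. of_int (adj_mat M $$ (0,j)) * (of_int (A j k) * b k))"
      by (simp add: sum_distrib_right mult.assoc)
    also have "\<dots> = (\<Sum>j<m. of_int (adj_mat M $$ (0,j)) * (\<Sum>k<m. of_int (A j k) * b k))"
      unfolding sum_distrib_left by (rule sum.swap)
    also have "\<dots> = (\<Sum>j<m. of_int (adj_mat M $$ (0,j)) * (z * b j))"
      using A(1) by (simp add: acts_def)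
    finally have eq: "of_int (det M) * b 0 = (\<Sum>j<m. of_int (adj_mat M $$ (0,j)) * (z * b j))" .
    have adjle: "real_of_int \<bar>adj_mat M $$ (0,j)\<bar> \<le> fact (m - 1) * B ^ (m - 1)" if "j < m" for j
    proof -
      have del: "mat_delete M j 0 \<in> carrier_mat (m - 1) (m - 1)"
        using M by (rule mat_delete_carrier)
      have "\<bar>adj_mat M $$ (0,j)\<bar> = \<bar>det (mat_delete M j 0)\<bar>"
        using that m_pos M by (simp add: adj_mat_def cofactor_def abs_mult power_abs)
      moreover have "real_of_int \<bar>det (mat_delete M j 0)\<bar> \<le> fact (m - 1) * B ^ (m - 1)"
        using A(2) that by (intro abs_det_le[OF del]) (auto simp: mat_delete_def M_def)
      ultimately show ?thesis by simp
    qed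
    have "\<bar>b 0\<bar> \<le> real_of_int \<bar>det M\<bar> * \<bar>b 0\<bar>" using det1 by (simp add: mult_le_cancel_right1)
    also have "\<dots> = \<bar>of_int (det M) * b 0\<bar>" by (simp add: abs_mult)
    also have "\<dots> \<le> (\<Sum>j<m. \<bar>of_int (adj_mat M $$ (0,j)) * (z * b j)\<bar>)"
      unfolding eq by (rule sum_abs)
    also have "\<dots> \<le> (\<Sum>j<m. fact (m - 1) * B ^ (m - 1) * (\<bar>z\<bar> * \<bar>b j\<bar>))"
      using adjle by (intro sum_mono) (simp add: abs_mult mult_right_mono)
    also have "\<dots> = \<bar>b 0\<bar> * (\<kappa> * \<bar>z\<bar> * B ^ (m - 1))"
      using b0 by (simp add: \<kappa>_def sum_distrib_left sum_distrib_right field_simps)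
    finally show ?thesis using b0 by (simp add: mult_le_cancel_left1)
  qed
  ultimately show ?thesis using that by blast
qed

lemma K_closed:
  shows K_0: "0 \<in> K" and K_1: "1 \<in> K"
    and K_mult: "x \<in> K \<Longrightarrow> y \<in> K \<Longrightarrow> x * y \<in> K"
  using subfield by (auto simp: is_subfield_def)

text \<open>One multiplier serves the whole set, so that numerator and denominator of F can be
  scaled together without changing their quotient.\<close>

lemma finite_integral_multiple:
  assumes S: "finite S" "S \<subseteq> K"
  shows "\<exists>(N::int) B. N > 0 \<and> (\<forall>z\<in>S. rep (of_int N * z) B)"
proof -
  have "\<exists>c. \<forall>j<m. z * b j = (\<Sum>k<m. of_rat (c j k) * b k)" if "z \<in> S" for z
  proof -
    have "\<forall>j. \<exists>c. j < m \<longrightarrow> z * b j = (\<Sum>k<m. of_rat (c k) * b k)"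
      using that S(2) b_in_K K_mult in_K by blast
    thus ?thesis by metis
  qed
  then obtain c :: "real \<Rightarrow> nat \<Rightarrow> nat \<Rightarrow> rat"
    where c: "\<And>z j. z \<in> S \<Longrightarrow> j < m \<Longrightarrow> z * b j = (\<Sum>k<m. of_rat (c z j k) * b k)"
    by metis
  define R where "R = (\<lambda>(z,j,k). c z j k) ` (S \<times> {..<m} \<times> {..<m})"
  have "finite R" using S(1) by (simp add: R_def)
  then obtain N :: int where N: "N > 0" "\<And>q. q \<in> R \<Longrightarrow> of_int N * q \<in> \<int>"
    using common_denominator by blast
  have cR: "c z j k \<in> R" if "z \<in> S" "j < m" "k < m" for z j k
    using that by (auto simp: R_def intro!: image_eqI[of _ _ "(z,j,k)"])
  define B where "B = (\<Sum>q\<in>R. \<bar>of_int N * q\<bar>)"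
  have "rep (of_int N * z) (of_rat B)" if z: "z \<in> S" for z
    unfolding rep_def
  proof (intro exI[of _ "\<lambda>j k. \<lfloor>of_int N * c z j k\<rfloor>"] conjI allI impI)
    have fl: "rat_of_int \<lfloor>of_int N * c z j k\<rfloor> = of_int N * c z j k" if "j < m" "k < m" for j k
      using N(2)[OF cR[OF z that]] by simp
    have fl': "real_of_int \<lfloor>of_int N * c z j k\<rfloor> = of_int N * of_rat (c z j k)"
      if "j < m" "k < m" for j k
      using arg_cong[OF fl[OF that], of of_rat] by (simp add: of_rat_mult)
    show "acts (\<lambda>j k. of_int \<lfloor>of_int N * c z j k\<rfloor>) (of_int N * z)"
      unfolding acts_def
    proof (intro allI impI)
      fix j assume j: "j < m"
      have "(\<Sum>k<m. real_of_int \<lfloor>of_int N * c z j k\<rfloor> * b k)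
          = of_int N * (\<Sum>k<m. of_rat (c z j k) * b k)"
        using fl' j by (simp add: sum_distrib_left mult.assoc)
      thus "(\<Sum>k<m. real_of_int \<lfloor>of_int N * c z j k\<rfloor> * b k) = of_int N * z * b j"
        using c[OF z j] by simp
    qed
    fix j k assume jk: "j < m" "k < m"
    have "\<bar>of_int N * c z j k\<bar> \<le> B"
      unfolding B_def using cR[OF z jk] \<open>finite R\<close>
      by (intro member_le_sum) auto
    hence "rat_of_int \<bar>\<lfloor>of_int N * c z j k\<rfloor>\<bar> \<le> B"
      using fl[OF jk] by (simp only: of_int_abs)
    hence "real_of_rat (of_int \<bar>\<lfloor>of_int N * c z j k\<rfloor>\<bar>) \<le> of_rat B"
      by (simp only: of_rat_less_eq)
    thus "real_of_int \<bar>\<lfloor>of_int N * c z j k\<rfloor>\<bar> \<le> of_rat B"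
      by (simp only: of_rat_of_int_eq)
  qed
  thus ?thesis using N(1) by (intro exI[of _ N] exI[of _ "of_rat B"]) simp
qed

end

subsection \<open>Algebraic relations between the variable and a rational function\<close>

text \<open>The outer variable of \<open>T\<close> is the value \<open>y\<close>, the inner one the
  argument \<open>x\<close>; hence \<open>degree T\<close> is the degree in
  \<open>y\<close>.\<close>

definition eval2 :: "int poly poly \<Rightarrow> real \<Rightarrow> real \<Rightarrow> real" where
  "eval2 T x y = poly (map_poly (\<lambda>t. poly (of_int_poly t) x) T) y"

lemma comm_ring_hom_eval: "comm_ring_hom (\<lambda>t. poly (of_int_poly t) (x::real))"
  by unfold_locales (simp_all add: hom_distribs)

lemma comm_ring_hom_eval2: "comm_ring_hom (\<lambda>T. eval2 T x y)"
proof -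
  interpret h: comm_ring_hom "\<lambda>t. poly (of_int_poly t) x" by (rule comm_ring_hom_eval)
  interpret h2: map_poly_comm_ring_hom "\<lambda>t. poly (of_int_poly t) x" ..
  show ?thesis by unfold_locales (simp_all add: eval2_def hom_distribs)
qed

lemma poly_eq_sum:
  fixes p :: "'a::comm_semiring_1 poly"
  assumes "degree p \<le> n"
  shows "poly p x = (\<Sum>i\<le>n. coeff p i * x ^ i)"
  unfolding poly_altdef using assms
  by (intro sum.mono_neutral_left) (auto simp: coeff_eq_0)

lemma eval2_eq_sum:
  assumes "degree T \<le> n"
  shows "eval2 T x y = (\<Sum>i\<le>n. poly (of_int_poly (coeff T i)) x * y ^ i)"
  unfolding eval2_def using assms degree_map_poly_le[of "\<lambda>t. poly (of_int_poly t) x" T]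
  by (subst poly_eq_sum[of _ n]) (auto simp: coeff_map_poly)

context number_basis
begin

text \<open>Integral matrices represent the coefficients, while the point enters as a scalar; this
  is why one matrix of integral polynomials serves every real \<open>x\<close>.\<close>

lemma poly_matrix:
  assumes "\<And>i. \<exists>B. rep (coeff P i) B"
  shows "\<exists>A :: nat \<Rightarrow> nat \<Rightarrow> int poly. \<forall>x. acts (\<lambda>j k. poly (of_int_poly (A j k)) x) (poly P x)"
  using assms
proof (induction P)
  case 0
  show ?case using acts_zero by (intro exI[of _ "\<lambda>j k. 0"]) simp
next
  case (pCons c p)
  have "\<exists>B. rep (coeff p i) B" for i using pCons.prems[of "Suc i"] by simp
  then obtain A where A: "\<And>x. acts (\<lambda>j k. poly (of_int_poly (A j k)) x) (poly p x)"
    using pCons.IH by blast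
  obtain C :: "nat \<Rightarrow> nat \<Rightarrow> int" where C: "acts (\<lambda>j k. of_int (C j k)) c"
    using pCons.prems[of 0] unfolding rep_def by auto
  show ?case
  proof (intro exI[of _ "\<lambda>j k. pCons (C j k) (A j k)"] allI)
    fix x
    show "acts (\<lambda>j k. poly (of_int_poly (pCons (C j k) (A j k))) x) (poly (pCons c p) x)"
      using acts_add[OF C acts_scale[OF A, of x x]] by (simp add: hom_distribs)
  qed
qed

text \<open>\<open>T\<close> is the determinant of y B(x) - A(x), where A(x) and B(x) act as P(x)
  and Q(x): a characteristic polynomial of the quotient that avoids division. The entries are linear
  in y, so the degree is at most \<open>m\<close>, and at y = P(x) / Q(x) the matrix annihilates
  \<open>b\<close>.\<close>

lemma algebraic_relation:
  assumes P: "\<And>i. \<exists>B. rep (coeff P i) B" and Q: "\<And>i. \<exists>B. rep (coeff Q i) B" "Q \<noteq> 0"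
  shows "\<exists>T. T \<noteq> 0 \<and> degree T \<le> m \<and> (\<forall>x. poly Q x \<noteq> 0 \<longrightarrow> eval2 T x (poly P x / poly Q x) = 0)"
proof -
  obtain A where A: "\<And>x. acts (\<lambda>j k. poly (of_int_poly (A j k)) x) (poly P x)"
    using poly_matrix[OF P] by blast
  obtain B where B: "\<And>x. acts (\<lambda>j k. poly (of_int_poly (B j k)) x) (poly Q x)"
    using poly_matrix[OF Q(1)] by blast
  define M where "M = mat m m (\<lambda>(j,k). [:- A j k, B j k:])"
  define T where "T = det M"
  let ?N = "\<lambda>x y j k. y * poly (of_int_poly (B j k)) x - poly (of_int_poly (A j k)) (x::real)"
  have N: "acts (?N x y) (y * poly Q x - poly P x)" for x y
    using acts_diff[OF acts_scale[OF B] A] .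
  have ev: "eval2 T x y = det (mat m m (\<lambda>(j,k). ?N x y j k))" for x y
  proof -
    interpret h: comm_ring_hom "\<lambda>T. eval2 T x y" by (rule comm_ring_hom_eval2)
    have "map_mat (\<lambda>T. eval2 T x y) M = mat m m (\<lambda>(j,k). ?N x y j k)"
      by (rule eq_matI) (auto simp: M_def eval2_eq_sum[of _ 1] hom_distribs)
    thus ?thesis unfolding T_def by (metis h.hom_det)
  qed
  have "eval2 T x (poly P x / poly Q x) = 0" if "poly Q x \<noteq> 0" for x
    unfolding ev using N[where x = x and y = "poly P x / poly Q x"] that by (intro det_eq_0) simp
  moreover have "degree T \<le> m"
    unfolding T_def using degree_det_le[of m M 1] by (simp add: M_def)
  \<comment> \<open>At integers x and y the matrix is integral. With Q(x) nonzero and y above P(x) /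
    Q(x) it acts as a nonzero number, so \<open>det_nonzero\<close> applies.\<close>
  moreover have "T \<noteq> 0"
  proof
    assume "T = 0"
    have "\<exists>x::int. poly Q (of_int x) \<noteq> 0"
    proof (rule ccontr)
      assume "\<not> ?thesis"
      hence "range of_int \<subseteq> {x. poly Q x = 0}" by auto
      moreover have "infinite (range (of_int :: int \<Rightarrow> real))"
        using infinite_UNIV_int by (simp add: finite_image_iff inj_def)
      ultimately show False using poly_roots_finite[OF Q(2)] finite_subset by blast
    qed
    then obtain x :: int where x: "poly Q (of_int x) \<noteq> 0" by blast
    obtain y :: int where y: "of_int y > poly P (of_int x) / poly Q (of_int x)"
      using ex_less_of_int by blast
    hence "of_int y \<noteq> poly P (of_int x) / poly Q (of_int x)" by simp
    hence nz: "of_int y * poly Q (of_int x) - poly P (of_int x) \<noteq> 0"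
      using x by (simp add: nonzero_eq_divide_eq)
    have eq: "?N (of_int x) (of_int y) j k = of_int (y * poly (B j k) x - poly (A j k) x)" for j k
      by simp
    have "det (mat m m (\<lambda>(j,k). y * poly (B j k) x - poly (A j k) x)) \<noteq> 0"
      using N[where x = "of_int x" and y = "of_int y"] nz unfolding eq by (intro det_nonzero)
    hence "real_of_int (det (mat m m (\<lambda>(j,k). y * poly (B j k) x - poly (A j k) x))) \<noteq> 0" by simp
    also have "real_of_int (det (mat m m (\<lambda>(j,k). y * poly (B j k) x - poly (A j k) x)))
        = det (map_mat of_int (mat m m (\<lambda>(j,k). y * poly (B j k) x - poly (A j k) x)))"
      by (simp only: of_int_hom.hom_det)
    also have "map_mat of_int (mat m m (\<lambda>(j,k). y * poly (B j k) x - poly (A j k) x))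
        = mat m m (\<lambda>(j,k). ?N (of_int x) (of_int y) j k)"
      by (rule eq_matI) auto
    also have "det \<dots> = eval2 T (of_int x) (of_int y)" by (simp only: ev)
    also have "\<dots> = 0" using \<open>T = 0\<close> by (simp add: eval2_def)
    finally show False by simp
  qed
  ultimately show ?thesis by blast
qed

end

lemma eval2_homogenize:
  assumes "degree T \<le> n" "poly Q x \<noteq> 0"
  shows "poly (\<Sum>i\<le>n. of_int_poly (coeff T i) * P ^ i * Q ^ (n - i)) x
    = poly Q x ^ n * eval2 T x (poly P x / poly Q x)"
  unfolding eval2_eq_sum[OF assms(1)] poly_sum sum_distrib_left using assms(2)
  by (intro sum.cong) (auto simp: poly_power field_simps simp flip: power_add)

lemma infinite_nonroots:
  fixes Q :: "real poly"
  assumes "Q \<noteq> 0"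
  shows "infinite {x. poly Q x \<noteq> 0}"
proof
  assume "finite {x. poly Q x \<noteq> 0}"
  hence "finite ({x. poly Q x \<noteq> 0} \<union> {x. poly Q x = 0})" using poly_roots_finite[OF assms] by simp
  moreover have "{x. poly Q x \<noteq> 0} \<union> {x. poly Q x = 0} = UNIV" by auto
  ultimately show False using infinite_UNIV_char_0[where 'a=real] by simp
qed

text \<open>Turns a pointwise relation into an identity of polynomials, which can then be expanded
  around any point.\<close>

lemma homogenized_eq_0:
  fixes Q :: "real poly"
  assumes "degree T \<le> n" "Q \<noteq> 0" "\<And>x. poly Q x \<noteq> 0 \<Longrightarrow> eval2 T x (poly P x / poly Q x) = 0"
  shows "(\<Sum>i\<le>n. of_int_poly (coeff T i) * P ^ i * Q ^ (n - i)) = 0" (is "?U = 0")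
proof (rule ccontr)
  assume "?U \<noteq> 0"
  hence "finite {x. poly ?U x = 0}" by (rule poly_roots_finite)
  moreover have "{x. poly Q x \<noteq> 0} \<subseteq> {x. poly ?U x = 0}"
    using eval2_homogenize[OF assms(1)] assms(3) by auto
  ultimately show False using infinite_nonroots[OF assms(2)] finite_subset by blast
qed

text \<open>For a relation of minimal degree, \<open>pderiv T\<close> is nonzero of smaller degree
  and hence no relation. Cleared of denominators it is a nonzero polynomial in x, with finitely many
  roots.\<close>

lemma separable_relation:
  fixes Q :: "real poly"
  assumes Q: "Q \<noteq> 0"
    and T: "\<exists>T. T \<noteq> 0 \<and> (\<forall>x. poly Q x \<noteq> 0 \<longrightarrow> eval2 T x (poly P x / poly Q x) = 0)"
  shows "\<exists>T. (\<forall>x. poly Q x \<noteq> 0 \<longrightarrow> eval2 T x (poly P x / poly Q x) = 0) \<and>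
    finite {x. poly Q x \<noteq> 0 \<and> eval2 (pderiv T) x (poly P x / poly Q x) = 0}"
proof -
  define R where "R T \<longleftrightarrow> T \<noteq> 0 \<and> (\<forall>x. poly Q x \<noteq> 0 \<longrightarrow> eval2 T x (poly P x / poly Q x) = 0)"
    for T
  obtain T where T: "R T" "\<And>T'. R T' \<Longrightarrow> degree T \<le> degree T'"
    using T ex_has_least_nat[of R _ degree] unfolding R_def by blast
  \<comment> \<open>A relation free of y would be a nonzero polynomial in x with infinitely many
    roots.\<close>
  have "degree T \<noteq> 0"
  proof
    assume d: "degree T = 0"
    hence "poly (of_int_poly (coeff T 0)) x = 0" if "poly Q x \<noteq> 0" for x
      using T(1) that eval2_eq_sum[of T 0 x] by (auto simp: R_def)
    hence "{x. poly Q x \<noteq> 0} \<subseteq> {x. poly (of_int_poly (coeff T 0)) x = 0}" by auto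
    hence "\<not> finite {x::real. poly (of_int_poly (coeff T 0)) x = 0}"
      using infinite_nonroots[OF Q] finite_subset by blast
    hence "coeff T 0 = 0" using poly_roots_finite[of "of_int_poly (coeff T 0) :: real poly"] by auto
    hence "T = 0" using d by (metis leading_coeff_0_iff)
    thus False using T(1) by (simp add: R_def)
  qed
  hence "pderiv T \<noteq> 0" "degree (pderiv T) < degree T"
    by (simp_all add: pderiv_eq_0_iff degree_pderiv)
  hence "\<not> R (pderiv T)" using T(2)[of "pderiv T"] by linarith
  then obtain x0 where x0: "poly Q x0 \<noteq> 0" "eval2 (pderiv T) x0 (poly P x0 / poly Q x0) \<noteq> 0"
    using \<open>pderiv T \<noteq> 0\<close> by (auto simp: R_def)
  let ?n = "degree (pderiv T)"
  let ?U = "\<Sum>i\<le>?n. of_int_poly (coeff (pderiv T) i) * P ^ i * Q ^ (?n - i)"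
  have "poly ?U x0 \<noteq> 0" 
    unfolding eval2_homogenize[OF order.refl x0(1)] using x0 by simp
  hence "?U \<noteq> 0" by (metis poly_0)
  hence "finite {x. poly ?U x = 0}" by (rule poly_roots_finite)
  moreover have "{x. poly Q x \<noteq> 0 \<and> eval2 (pderiv T) x (poly P x / poly Q x) = 0} \<subseteq> {x. poly ?U x = 0}"
    using eval2_homogenize[OF order.refl, of Q _ "pderiv T" P] by auto
  ultimately have "finite {x. poly Q x \<noteq> 0 \<and> eval2 (pderiv T) x (poly P x / poly Q x) = 0}"
    by (rule rev_finite_subset)
  thus ?thesis using T(1) unfolding R_def by blast
qed

subsection \<open>Rational functions over a subfield\<close>

lemma subfield_closed:
  assumes "is_subfield L"
  shows subfield_0: "0 \<in> L" and subfield_1: "1 \<in> L"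
    and subfield_diff: "x \<in> L \<Longrightarrow> y \<in> L \<Longrightarrow> x - y \<in> L"
    and subfield_mult: "x \<in> L \<Longrightarrow> y \<in> L \<Longrightarrow> x * y \<in> L"
    and subfield_inverse: "x \<in> L \<Longrightarrow> inverse x \<in> L"
  using assms by (auto simp: is_subfield_def)

lemma subfield_uminus:
  assumes "is_subfield L" "x \<in> L" shows "- x \<in> L"
  using subfield_diff[OF assms(1) subfield_0[OF assms(1)] assms(2)] by simp

lemma subfield_add:
  assumes "is_subfield L" "x \<in> L" "y \<in> L" shows "x + y \<in> L"
  using subfield_diff[OF assms(1,2) subfield_uminus[OF assms(1,3)]] by simp

lemma subfield_divide:
  assumes "is_subfield L" "x \<in> L" "y \<in> L" shows "x / y \<in> L"
  using subfield_mult[OF assms(1,2) subfield_inverse[OF assms(1,3)]] by (simp add: divide_inverse)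

lemma subfield_sum:
  assumes "is_subfield L" "\<And>i. i \<in> I \<Longrightarrow> f i \<in> L" shows "(\<Sum>i\<in>I. f i) \<in> L"
  using assms(2)
  by (induction I rule: infinite_finite_induct)
    (simp_all add: subfield_0[OF assms(1)] subfield_add[OF assms(1)])

lemma subfield_power:
  assumes "is_subfield L" "x \<in> L" shows "x ^ n \<in> L"
  by (induction n) (simp_all add: subfield_1[OF assms(1)] subfield_mult[OF assms(1,2)])

lemma subfield_of_nat:
  assumes "is_subfield L" shows "of_nat n \<in> L"
  by (induction n) (simp_all add: subfield_0[OF assms] subfield_1[OF assms] subfield_add[OF assms])

lemma subfield_of_int:
  assumes "is_subfield L" shows "of_int n \<in> L"
  by (cases n) (simp_all add: subfield_of_nat[OF assms] subfield_uminus[OF assms] del: of_nat_Suc)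

lemma subfield_of_rat:
  assumes "is_subfield L" shows "of_rat q \<in> L"
proof -
  have "q = of_int (fst (quotient_of q)) / of_int (snd (quotient_of q))"
    by (rule quotient_of_div) simp
  hence "of_rat q = (of_int (fst (quotient_of q)) / of_int (snd (quotient_of q)) :: real)"
    by (metis of_rat_divide of_rat_of_int_eq)
  thus ?thesis using subfield_divide subfield_of_int assms by simp
qed

lemma coeffs_in_subfield_mult:
  assumes L: "is_subfield L" and "\<And>i. coeff p i \<in> L" "\<And>i. coeff q i \<in> L"
  shows "coeff (p * q) i \<in> L"
  unfolding coeff_mult using assms(2,3) by (intro subfield_sum[OF L] subfield_mult[OF L])

lemma coeffs_in_subfield_pcompose:
  assumes L: "is_subfield L" and "\<And>i. coeff p i \<in> L" and q: "\<And>i. coeff q i \<in> L"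
  shows "coeff (pcompose p q) i \<in> L"
  using assms(2)
proof (induction p arbitrary: i)
  case 0
  show ?case by (simp add: subfield_0[OF L])
next
  case (pCons a p)
  have a: "a \<in> L" using pCons.prems[of 0] by simp
  have "coeff p i \<in> L" for i using pCons.prems[of "Suc i"] by simp
  hence "coeff (pcompose p q) i \<in> L" for i using pCons.IH by blast
  hence "coeff (q * pcompose p q) i \<in> L" by (rule coeffs_in_subfield_mult[OF L q])
  thus ?case using a
    by (auto simp: pcompose_pCons coeff_pCons subfield_0[OF L] intro!: subfield_add[OF L] split: nat.split)
qed

section \<open>Power series roots and linear systems over a subfield\<close>

lemma fps_power_in_subfield:
  assumes L: "is_subfield L" and "\<And>n. fps_nth f n \<in> L"
  shows "fps_nth (f ^ i) n \<in> L"
proof (induction i arbitrary: n)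
  case 0
  show ?case by (simp add: fps_one_nth subfield_0[OF L] subfield_1[OF L])
next
  case (Suc i)
  show ?case using assms(2) Suc
    by (auto simp: fps_mult_nth intro!: subfield_sum[OF L] subfield_mult[OF L])
qed

text \<open>Newton iteration: the relation determines each coefficient of \<open>f\<close> linearly in terms
  of the preceding ones.\<close>

lemma fps_root_in_subfield:
  fixes f :: "real fps"
  assumes L: "is_subfield L" and t: "\<And>i n. fps_nth (t i) n \<in> L"
    and root: "(\<Sum>i\<le>e. t i * f ^ i) = 0"
    and simple: "(\<Sum>i\<le>e. of_nat i * fps_nth (t i) 0 * fps_nth f 0 ^ (i - 1)) \<noteq> 0"
    and f0: "fps_nth f 0 \<in> L"
  shows "fps_nth f n \<in> L"
proof (induction n rule: less_induct)
  case (less n)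
  show ?case
  proof (cases "n = 0")
    case True
    thus ?thesis using f0 by simp
  next
    case False
    \<comment> \<open>\<open>g\<close> truncates \<open>f\<close> below order \<open>n\<close>, and
      \<open>W i\<close> is the cofactor of \<open>f - g\<close> in \<open>f ^ i - g ^ i\<close>. As
      \<open>f - g\<close> starts at order \<open>n\<close> or later, coefficient \<open>n\<close>
      of a multiple of it sees only the constant term of the cofactor; these add up to
      \<open>s\<close>, the derivative of the relation at the constant terms.\<close>
    define g where "g = Abs_fps (\<lambda>k. if k < n then fps_nth f k else 0)"
    define W where "W i = (\<Sum>j<i. g ^ (i - Suc j) * f ^ j)" for i
    define s where "s = (\<Sum>i\<le>e. of_nat i * fps_nth (t i) 0 * fps_nth f 0 ^ (i - 1))"
    have g: "fps_nth g k \<in> L" for k using less subfield_0[OF L] by (simp add: g_def)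
    have g0: "fps_nth g 0 = fps_nth f 0" using False by (simp add: g_def)
    have W0: "fps_nth (W i) 0 = of_nat i * fps_nth f 0 ^ (i - 1)" for i
    proof -
      have "fps_nth (W i) 0 = (\<Sum>j<i. fps_nth f 0 ^ (i - 1))"
        unfolding W_def fps_sum_nth
        by (intro sum.cong) (auto simp: g0 fps_power_zeroth simp flip: power_add)
      thus ?thesis by simp
    qed
    have coeff: "fps_nth ((f - g) * h) n = fps_nth f n * fps_nth h 0" for h
    proof -
      have "fps_nth ((f - g) * h) n = (\<Sum>i=0..n. if i = n then fps_nth f n * fps_nth h 0 else 0)"
        unfolding fps_mult_nth by (intro sum.cong) (auto simp: g_def)
      thus ?thesis by simp
    qed
    have "t i * f ^ i = t i * g ^ i + (f - g) * (t i * W i)" for i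
    proof -
      have "f ^ i - g ^ i = (f - g) * W i"
        unfolding W_def by (rule power_diff_sumr2)
      hence "f ^ i = g ^ i + (f - g) * W i" by (simp add: algebra_simps)
      thus ?thesis by (simp only: distrib_left mult.left_commute)
    qed
    hence "0 = fps_nth (\<Sum>i\<le>e. t i * g ^ i + (f - g) * (t i * W i)) n"
      using root by simp
    also have "\<dots> = (\<Sum>i\<le>e. fps_nth (t i * g ^ i) n) + fps_nth f n * s"
      by (simp only: fps_sum_nth fps_add_nth coeff)
        (simp add: sum.distrib W0 s_def sum_distrib_left mult_ac)
    finally have "fps_nth f n = - (\<Sum>i\<le>e. fps_nth (t i * g ^ i) n) / s"
      using simple by (simp add: s_def field_simps)
    moreover have "s \<in> L"
      unfolding s_def using t f0 L
      by (intro subfield_sum subfield_mult subfield_of_nat subfield_power)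
    moreover have "(\<Sum>i\<le>e. fps_nth (t i * g ^ i) n) \<in> L"
      unfolding fps_mult_nth using t fps_power_in_subfield[OF L g] L
      by (intro subfield_sum subfield_mult)
    ultimately show ?thesis
      using L by (simp only: subfield_divide subfield_uminus)
  qed
qed

text \<open>Gaussian elimination never leaves the field of the coefficients, so solvability passes
  from the reals down to \<open>L\<close>. Each step removes one unknown by one pivot equation,
  which works for an infinite \<open>E\<close> as well.\<close>

lemma homogeneous_system_in_subfield:
  fixes E :: "(nat \<Rightarrow> real) set"
  assumes L: "is_subfield L" and "\<And>a i. a \<in> E \<Longrightarrow> a i \<in> L"
    and "i < n" "x i \<noteq> 0" "\<And>a. a \<in> E \<Longrightarrow> (\<Sum>i<n. a i * x i) = 0"
  shows "\<exists>y. (\<forall>i. y i \<in> L) \<and> (\<exists>i<n. y i \<noteq> 0) \<and> (\<forall>a\<in>E. (\<Sum>i<n. a i * y i) = (0::real))"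
  using assms(2-)
proof (induction n arbitrary: E i)
  case 0
  thus ?case by simp
next
  case (Suc n)
  show ?case
  proof (cases "\<forall>a\<in>E. a n = 0")
    case True
    show ?thesis using True
      by (intro exI[of _ "\<lambda>i. of_bool (i = n)"])
        (auto simp: subfield_0[OF L] subfield_1[OF L] of_bool_def intro!: sum.neutral)
  next
    case False
    then obtain a where a: "a \<in> E" "a n \<noteq> 0" by blast
    define E' where "E' = (\<lambda>c i. c i - c n / a n * a i) ` E"
    have ax: "(\<Sum>i<n. a i * x i) = - a n * x n" using Suc.prems(4)[OF a(1)] by simp
    \<comment> \<open>If \<open>x\<close> vanished below \<open>n\<close>, the pivot equation would
      make \<open>x n\<close> vanish too.\<close>
    have nz: "\<exists>i<n. x i \<noteq> 0"
    proof (rule ccontr)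
      assume none: "\<not> ?thesis"
      hence "x n \<noteq> 0" using Suc.prems(2,3) less_Suc_eq by auto
      moreover have "(\<Sum>i<n. a i * x i) = 0" using none by (intro sum.neutral) auto
      ultimately show False using ax a(2) by simp
    qed
    have E'L: "c i \<in> L" if "c \<in> E'" for c i
      using that Suc.prems(1) a(1)
      by (auto simp: E'_def intro!: subfield_diff[OF L] subfield_mult[OF L] subfield_divide[OF L])
    have red: "(\<Sum>i<n. (c i - c n / a n * a i) * z i)
        = (\<Sum>i<n. c i * z i) - c n / a n * (\<Sum>i<n. a i * z i)" for c z
      by (simp add: algebra_simps sum_subtractf sum_distrib_left)
    have "(\<Sum>i<n. c i * x i) = 0" if "c \<in> E'" for c
    proof -
      obtain c' where c': "c' \<in> E" "c = (\<lambda>i. c' i - c' n / a n * a i)" using \<open>c \<in> E'\<close> by (auto simp: E'_def)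
      have "(\<Sum>i<n. c' i * x i) = - c' n * x n" using Suc.prems(4)[OF c'(1)] by simp
      thus ?thesis unfolding c'(2) red ax using a(2) by simp
    qed
    then obtain y where y: "\<And>i. y i \<in> L" "\<exists>i<n. y i \<noteq> 0" "\<And>c. c \<in> E' \<Longrightarrow> (\<Sum>i<n. c i * y i) = 0"
      using nz Suc.IH[of E'] E'L by blast
    define z where "z = y(n := - (\<Sum>i<n. a i * y i) / a n)"
    have "z i \<in> L" for i
      using y(1) Suc.prems(1)[OF a(1)] unfolding z_def
      by (auto intro!: subfield_divide[OF L] subfield_uminus[OF L] subfield_sum[OF L] subfield_mult[OF L])
    moreover have "\<exists>i<Suc n. z i \<noteq> 0" using y(2) by (auto simp: z_def)
    moreover have "(\<Sum>i<Suc n. c i * z i) = 0" if "c \<in> E" for c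
    proof -
      have "(\<Sum>i<n. (c i - c n / a n * a i) * y i) = 0"
        using that by (intro y(3)) (auto simp: E'_def)
      thus ?thesis unfolding red by (simp add: z_def)
    qed
    ultimately show ?thesis by blast
  qed
qed

lemma sum_convolution_bounded:
  fixes c F :: "nat \<Rightarrow> real"
  assumes "\<And>i. i \<ge> n \<Longrightarrow> c i = 0"
  shows "(\<Sum>i<n. (if i \<le> j then F (j - i) else 0) * c i) = (\<Sum>i=0..j. c i * F (j - i))"
proof -
  have "(\<Sum>i<n. (if i \<le> j then F (j - i) else 0) * c i)
      = (\<Sum>i\<in>{..<n} \<union> {0..j}. (if i \<le> j then F (j - i) else 0) * c i)"
    using assms by (intro sum.mono_neutral_left) auto
  also have "\<dots> = (\<Sum>i=0..j. c i * F (j - i))"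
    by (intro sum.mono_neutral_cong_right) (auto simp: mult.commute)
  finally show ?thesis .
qed

lemma coeff_sum_monom: "coeff (\<Sum>i<n. monom (y i) i) k = (if k < n then y k else (0::real))"
  by (simp add: coeff_sum coeff_monom if_distrib cong: if_cong)

lemma pcompose_shift_cancel: "pcompose (pcompose p [:r, 1:]) [:- r, 1:] = (p::real poly)"
  by (simp flip: pcompose_assoc add: pcompose_pCons pcompose_idR)

text \<open>The coefficients of a \<open>Q1\<close> of bounded degree for which
  \<open>Q1 * f\<close> has no terms beyond the degree of the shifted \<open>P\<close> solve a
  linear system over \<open>L\<close> (Pade equations). The shifted \<open>Q\<close> is a nonzero
  real solution, so there is one over \<open>L\<close>; then \<open>Q1 * f\<close> is a polynomial
  over \<open>L\<close>, and undoing the shift by \<open>r\<close> stays in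
  \<open>L\<close>.\<close>

lemma ratfun_over_if_taylor_in_subfield:
  fixes P Q :: "real poly"
  assumes L: "is_subfield L" and r: "r \<in> L" and Q: "Q \<noteq> 0"
    and f: "f * fps_of_poly (pcompose Q [:r, 1:]) = fps_of_poly (pcompose P [:r, 1:])"
    and fL: "\<And>n. fps_nth f n \<in> L"
  shows "ratfun_over L (Fract P Q)"
proof -
  define P' where "P' = pcompose P [:r, 1:]"
  define Q' where "Q' = pcompose Q [:r, 1:]"
  have Q'0: "Q' \<noteq> 0" using Q pcompose_eq_0[of Q "[:r, 1:]"] by (auto simp: Q'_def)
  define n where "n = Suc (degree Q')"
  define E where "E = (\<lambda>j i. if i \<le> j then fps_nth f (j - i) else 0) ` {degree P'<..}"
  have "\<exists>y. (\<forall>i. y i \<in> L) \<and> (\<exists>i<n. y i \<noteq> 0) \<and> (\<forall>a\<in>E. (\<Sum>i<n. a i * y i) = 0)"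
  proof (rule homogeneous_system_in_subfield[OF L, where x = "coeff Q'" and i = "degree Q'"])
    fix a i assume "a \<in> E"
    thus "a i \<in> L" using fL subfield_0[OF L] by (auto simp: E_def)
  next
    show "degree Q' < n" "coeff Q' (degree Q') \<noteq> 0" using Q'0 by (simp_all add: n_def)
  next
    fix a assume "a \<in> E"
    then obtain j where j: "j > degree P'" "a = (\<lambda>i. if i \<le> j then fps_nth f (j - i) else 0)"
      by (auto simp: E_def)
    have "(\<Sum>i<n. a i * coeff Q' i) = (\<Sum>i=0..j. coeff Q' i * fps_nth f (j - i))"
      unfolding j(2) by (rule sum_convolution_bounded) (simp add: n_def coeff_eq_0)
    also have "\<dots> = fps_nth (fps_of_poly Q' * f) j" by (simp add: fps_mult_nth)
    also have "\<dots> = 0" using f j(1) by (simp add: mult.commute P'_def Q'_def coeff_eq_0)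
    finally show "(\<Sum>i<n. a i * coeff Q' i) = 0" .
  qed
  then obtain y where y: "\<And>i. y i \<in> L" "\<exists>i<n. y i \<noteq> 0" "\<And>a. a \<in> E \<Longrightarrow> (\<Sum>i<n. a i * y i) = 0"
    by blast
  define Q1 where "Q1 = (\<Sum>i<n. monom (y i) i)"
  define P1 where "P1 = (\<Sum>i<Suc (degree P'). monom (fps_nth (fps_of_poly Q1 * f) i) i)"
  have Q1: "coeff Q1 i = (if i < n then y i else 0)" for i
    unfolding Q1_def by (rule coeff_sum_monom)
  hence Q1L: "coeff Q1 i \<in> L" for i using y(1) subfield_0[OF L] by auto
  have Q10: "Q1 \<noteq> 0" using y(2) Q1 by (metis coeff_0)
  have P1: "coeff P1 i = (if i < Suc (degree P') then fps_nth (fps_of_poly Q1 * f) i else 0)" for i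
    unfolding P1_def by (rule coeff_sum_monom)
  have P1L: "coeff P1 i \<in> L" for i
    using Q1L fL
    by (auto simp: P1 fps_mult_nth subfield_0[OF L] intro!: subfield_sum[OF L] subfield_mult[OF L])
  have "fps_nth (fps_of_poly Q1 * f) j = 0" if "j > degree P'" for j
  proof -
    have "fps_nth (fps_of_poly Q1 * f) j = (\<Sum>i=0..j. coeff Q1 i * fps_nth f (j - i))"
      by (simp add: fps_mult_nth)
    also have "\<dots> = (\<Sum>i<n. (if i \<le> j then fps_nth f (j - i) else 0) * coeff Q1 i)"
      by (rule sum_convolution_bounded[symmetric]) (simp add: Q1)
    also have "\<dots> = (\<Sum>i<n. (if i \<le> j then fps_nth f (j - i) else 0) * y i)"
      by (intro sum.cong) (simp_all add: Q1)
    also have "\<dots> = 0" using that by (intro y(3)) (auto simp: E_def)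
    finally show ?thesis .
  qed
  hence "fps_of_poly Q1 * f = fps_of_poly P1"
    by (intro fps_ext) (simp add: P1)
  hence "fps_of_poly (P' * Q1) = fps_of_poly (P1 * Q')"
    using f by (simp add: fps_of_poly_mult P'_def Q'_def algebra_simps flip: f)
  hence "P' * Q1 = P1 * Q'" by simp
  hence "pcompose (P' * Q1) [:- r, 1:] = pcompose (P1 * Q') [:- r, 1:]" by simp
  hence "P * pcompose Q1 [:- r, 1:] = pcompose P1 [:- r, 1:] * Q"
    by (simp add: pcompose_mult P'_def Q'_def pcompose_shift_cancel)
  moreover have Q1'0: "pcompose Q1 [:- r, 1:] \<noteq> 0"
    using Q10 pcompose_eq_0[of Q1 "[:- r, 1:]"] by auto
  ultimately have "Fract P Q = Fract (pcompose P1 [:- r, 1:]) (pcompose Q1 [:- r, 1:])"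
    using Q by (simp add: eq_fract)
  moreover have "coeff [:- r, 1:] i \<in> L" for i
    using r by (auto simp: coeff_pCons subfield_0[OF L] subfield_1[OF L] subfield_uminus[OF L] split: nat.split)
  hence "coeff (pcompose P1 [:- r, 1:]) i \<in> L" "coeff (pcompose Q1 [:- r, 1:]) i \<in> L" for i
    using coeffs_in_subfield_pcompose[OF L] P1L Q1L by blast+
  hence "set (coeffs (pcompose P1 [:- r, 1:])) \<subseteq> L" "set (coeffs (pcompose Q1 [:- r, 1:])) \<subseteq> L"
    unfolding coeffs_def by auto
  ultimately show ?thesis using Q1'0 unfolding ratfun_over_def by blast
qed

subsection \<open>Degrees of values at rational points\<close>

text \<open>The ring generated by \<open>\<alpha>\<close> over the rationals; it is shown to be a
  field where its elements are known to be algebraic.\<close>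

definition simple_extension :: "real \<Rightarrow> real set" where
  "simple_extension \<alpha> = {z. \<exists>p. z = poly (map_poly of_rat p) \<alpha>}"

lemma simple_extensionI: "z = poly (map_poly of_rat p) \<alpha> \<Longrightarrow> z \<in> simple_extension \<alpha>"
  by (auto simp: simple_extension_def)

lemma simple_extensionE:
  assumes "z \<in> simple_extension \<alpha>"
  obtains p where "z = poly (map_poly of_rat p) \<alpha>"
  using assms by (auto simp: simple_extension_def)

lemma poly_map_of_rat_of_int: "map_poly of_rat (of_int_poly p) = (of_int_poly p :: real poly)"
  by (simp add: map_poly_map_poly o_def)

lemma poly_of_rat_hom:
  fixes \<alpha> :: real
  shows "poly (map_poly of_rat (p + q)) \<alpha> = poly (map_poly of_rat p) \<alpha> + poly (map_poly of_rat q) \<alpha>"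
    and "poly (map_poly of_rat (p - q)) \<alpha> = poly (map_poly of_rat p) \<alpha> - poly (map_poly of_rat q) \<alpha>"
    and "poly (map_poly of_rat (p * q)) \<alpha> = poly (map_poly of_rat p) \<alpha> * poly (map_poly of_rat q) \<alpha>"
    and "poly (map_poly of_rat (Polynomial.smult c p)) \<alpha> = of_rat c * poly (map_poly of_rat p) \<alpha>"
proof -
  interpret h: map_poly_comm_ring_hom "of_rat :: rat \<Rightarrow> real" ..
  show "poly (map_poly of_rat (p + q)) \<alpha> = poly (map_poly of_rat p) \<alpha> + poly (map_poly of_rat q) \<alpha>"
    "poly (map_poly of_rat (p - q)) \<alpha> = poly (map_poly of_rat p) \<alpha> - poly (map_poly of_rat q) \<alpha>"
    "poly (map_poly of_rat (p * q)) \<alpha> = poly (map_poly of_rat p) \<alpha> * poly (map_poly of_rat q) \<alpha>"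
    "poly (map_poly of_rat (Polynomial.smult c p)) \<alpha> = of_rat c * poly (map_poly of_rat p) \<alpha>"
    by (simp_all add: h.hom_add h.hom_minus h.hom_mult of_rat_hom.map_poly_hom_smult)
qed

lemma pcompose_power: "pcompose (p ^ n) q = pcompose p q ^ n"
  for p :: "'a::comm_semiring_1 poly"
  by (induction n) (simp_all add: pcompose_mult pcompose_1)

lemma algebraicI_int:
  assumes "p \<noteq> 0" "poly (of_int_poly p) \<alpha> = (0::real)"
  shows "algebraic \<alpha>"
  unfolding algebraic_def using assms by (intro exI[of _ "of_int_poly p"]) auto

lemma algebraic_int_poly:
  fixes \<alpha> :: real
  assumes "algebraic \<alpha>"
  shows "int_minpoly \<alpha> \<noteq> 0" "poly (of_int_poly (int_minpoly \<alpha>)) \<alpha> = 0"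
    "lead_coeff (int_minpoly \<alpha>) > 0" "content (int_minpoly \<alpha>) = 1"
    "\<And>q. q \<noteq> 0 \<Longrightarrow> poly (of_int_poly q) \<alpha> = 0 \<Longrightarrow> alg_degree \<alpha> \<le> degree q"
  using int_minpoly[OF assms] by (auto simp: is_int_minpoly_def alg_degree_def)

text \<open>Writing the minimal polynomial as \<open>pCons c q'\<close> gives c + z q'(z) = 0. If
  \<open>c\<close> were 0, \<open>q'\<close> would annihilate \<open>z\<close> in smaller degree; so
  division by \<open>c\<close> exhibits the inverse as a polynomial in \<open>z\<close>.\<close>

lemma inverse_algebraic:
  fixes z :: real
  assumes z: "algebraic z" "z \<noteq> 0"
  shows "inverse z \<in> simple_extension z"
proof -
  define q where "q = int_minpoly z"
  obtain c q' where q: "q = pCons c q'" by (cases q)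
  have root: "of_int c + z * poly (of_int_poly q') z = 0"
    using algebraic_int_poly(2)[OF z(1)] q by (simp add: q_def hom_distribs)
  have c: "c \<noteq> 0"
  proof
    assume "c = 0"
    hence "poly (of_int_poly q') z = 0" "q' \<noteq> 0"
      using root z(2) algebraic_int_poly(1)[OF z(1)] q by (auto simp: q_def)
    hence "degree q \<le> degree q'"
      using algebraic_int_poly(5)[OF z(1)] by (simp add: q_def alg_degree_def)
    thus False using \<open>q' \<noteq> 0\<close> q by simp
  qed
  have "inverse z = poly (map_poly of_rat (Polynomial.smult (- inverse (of_int c)) (of_int_poly q'))) z"
    unfolding poly_of_rat_hom poly_map_of_rat_of_int of_rat_minus of_rat_inverse of_rat_of_int_eq
    using root z(2) c by (simp add: field_simps)
  thus ?thesis by (rule simple_extensionI)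
qed

text \<open>The inverse of an element is a polynomial in that element, hence by composition a
  polynomial in \<open>\<alpha>\<close>. Algebraicity of all elements is supplied by the ambient
  number field.\<close>

lemma is_subfield_simple_extension:
  assumes alg: "\<And>z. z \<in> simple_extension \<alpha> \<Longrightarrow> algebraic z"
  shows "is_subfield (simple_extension \<alpha>)"
proof -
  let ?h = "\<lambda>p. poly (map_poly of_rat p) \<alpha>"
  have inv: "inverse z \<in> simple_extension \<alpha>" if z: "z \<in> simple_extension \<alpha>" for z
  proof (cases "z = 0")
    case True
    thus ?thesis using z by simp
  next
    case False
    then obtain q where q: "inverse z = poly (map_poly of_rat q) z"
      using inverse_algebraic[OF alg[OF z]] by (auto elim: simple_extensionE)
    obtain p where p: "z = ?h p" using z by (rule simple_extensionE)
    have "inverse z = ?h (pcompose q p)"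
      using q by (simp add: p of_rat_hom.map_poly_pcompose poly_pcompose)
    thus ?thesis by (rule simple_extensionI)
  qed
  have closed: "z - w \<in> simple_extension \<alpha> \<and> z * w \<in> simple_extension \<alpha>"
    if z: "z \<in> simple_extension \<alpha>" and w: "w \<in> simple_extension \<alpha>" for z w
  proof -
    obtain p where "z = ?h p" using z by (rule simple_extensionE)
    moreover obtain q where "w = ?h q" using w by (rule simple_extensionE)
    ultimately have "z - w = ?h (p - q)" "z * w = ?h (p * q)" by (simp_all add: poly_of_rat_hom)
    thus ?thesis by (blast intro: simple_extensionI)
  qed
  have "0 \<in> simple_extension \<alpha>" "1 \<in> simple_extension \<alpha>"
    by (rule simple_extensionI[of _ 0], simp, rule simple_extensionI[of _ 1], simp)
  thus ?thesis
    unfolding is_subfield_def using inv closed by simp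
qed

text \<open>Remainders modulo the minimal polynomial span the extension. Once the extension is known
  to be all of \<open>K\<close>, this bounds the degree of \<open>\<alpha>\<close> from
  below.\<close>

lemma dim_simple_extension_le:
  fixes \<alpha> :: real
  assumes "algebraic \<alpha>"
  shows "field_degree (simple_extension \<alpha>) \<le> alg_degree \<alpha>"
proof -
  interpret vector_space rat_scale by (rule vector_space_rat_scale)
  define n where "n = alg_degree \<alpha>"
  define g where "g = (of_int_poly (int_minpoly \<alpha>) :: rat poly)"
  have g: "g \<noteq> 0" "degree g = n" "poly (map_poly of_rat g) \<alpha> = 0"
    using algebraic_int_poly[OF assms] by (auto simp: g_def n_def alg_degree_def poly_map_of_rat_of_int)
  have npos: "n > 0"
  proof (rule ccontr)
    assume "\<not> n > 0"
    then obtain c where "g = [:c:]" using g(2) degree_eq_zeroE by blast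
    thus False using g(1,3) by (simp add: hom_distribs)
  qed
  have "simple_extension \<alpha> \<subseteq> span ((\<lambda>i. \<alpha> ^ i) ` {..<n})"
  proof
    fix z assume "z \<in> simple_extension \<alpha>"
    then obtain p where p: "z = poly (map_poly of_rat p) \<alpha>" by (rule simple_extensionE)
    define r where "r = p mod g"
    have "p = p div g * g + r" by (simp add: r_def)
    hence "z = poly (map_poly of_rat (p div g * g + r)) \<alpha>" using p by simp
    also have "\<dots> = poly (map_poly of_rat r) \<alpha>" using g(3) by (simp add: poly_of_rat_hom)
    also have "\<dots> = (\<Sum>i\<le>n - 1. rat_scale (coeff r i) (\<alpha> ^ i))"
      using degree_mod_less[OF g(1), of p] npos g(2) degree_map_poly_le[of of_rat r]
      by (subst poly_eq_sum[of _ "n - 1"]) (auto simp: r_def rat_scale_def)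
    also have "\<dots> \<in> span ((\<lambda>i. \<alpha> ^ i) ` {..<n})"
      using npos by (intro span_sum span_scale span_base) auto
    finally show "z \<in> span ((\<lambda>i. \<alpha> ^ i) ` {..<n})" .
  qed
  hence "dim (simple_extension \<alpha>) \<le> card ((\<lambda>i. \<alpha> ^ i) ` {..<n})"
    by (intro dim_le_card) auto
  also have "\<dots> \<le> n" using card_image_le[of "{..<n}" "\<lambda>i. \<alpha> ^ i"] by simp
  finally show ?thesis by (simp add: field_degree_def n_def)
qed

lemma specialize_relation:
  assumes "T \<noteq> 0"
  shows "\<exists>x::int. map_poly (\<lambda>t. poly t x) T \<noteq> (0 :: int poly)"
proof -
  obtain i where i: "coeff T i \<noteq> 0" using assms by (metis leading_coeff_0_iff)
  have "finite {x. poly (coeff T i) x = 0}" using i by (rule poly_roots_finite)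
  hence "{x. poly (coeff T i) x = 0} \<noteq> UNIV" using infinite_UNIV_int by metis
  then obtain x where "poly (coeff T i) x \<noteq> 0" by blast
  hence "coeff (map_poly (\<lambda>t. poly t x) T) i \<noteq> 0" by (simp add: coeff_map_poly)
  thus ?thesis by (metis coeff_0)
qed

lemma finite_rat_if_finite_real:
  assumes "finite {x::real. R x}"
  shows "finite {r::rat. R (of_rat r)}"
  using finite_vimageI[OF assms, of of_rat] by (simp add: inj_def vimage_def)

section \<open>Values of a rational function over \<open>K\<close> at rational points\<close>

context number_basis
begin

lemma poly_in_K:
  assumes "\<And>i. coeff P i \<in> K" "x \<in> K"
  shows "poly P x \<in> K"
  unfolding poly_altdef using assms
  by (intro subfield_sum[OF subfield] subfield_mult[OF subfield] subfield_power[OF subfield])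

lemma integral_multiple:
  assumes "\<And>i. coeff P i \<in> K" "\<And>i. coeff Q i \<in> K"
  shows "\<exists>N::int. N > 0 \<and> (\<exists>B. \<forall>i. rep (coeff (Polynomial.smult (of_int N) P) i) B \<and>
    rep (coeff (Polynomial.smult (of_int N) Q) i) B)"
proof -
  \<comment> \<open>The 0 stands for the coefficients beyond the degree, which \<open>coeffs\<close>
    does not list.\<close>
  let ?S = "insert 0 (set (coeffs P) \<union> set (coeffs Q))"
  have "?S \<subseteq> K" using assms K_0 unfolding coeffs_def by auto
  then obtain N :: int and B where N: "N > 0" "\<forall>z\<in>?S. rep (of_int N * z) B"
    using finite_integral_multiple[of ?S] by auto
  have "coeff p i \<in> insert 0 (set (coeffs p))" for p :: "real poly" and i
    by (cases "i \<le> degree p \<and> p \<noteq> 0") (auto simp: coeff_in_coeffs coeff_eq_0)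
  hence "coeff P i \<in> ?S" "coeff Q i \<in> ?S" for i by blast+
  hence "rep (coeff (Polynomial.smult (of_int N) P) i) B \<and> rep (coeff (Polynomial.smult (of_int N) Q) i) B" for i
    unfolding coeff_smult using N(2) by blast
  thus ?thesis using N(1) by (intro exI[of _ N] exI[of _ B] conjI) simp_all
qed

lemma algebraic_relation_K:
  assumes "\<And>i. coeff P i \<in> K" "\<And>i. coeff Q i \<in> K" "Q \<noteq> 0"
  shows "\<exists>T. T \<noteq> 0 \<and> degree T \<le> m \<and> (\<forall>x. poly Q x \<noteq> 0 \<longrightarrow> eval2 T x (poly P x / poly Q x) = 0)"
proof -
  obtain N :: int and B where N: "N > 0"
    "\<And>i. rep (coeff (Polynomial.smult (of_int N) P) i) B" "\<And>i. rep (coeff (Polynomial.smult (of_int N) Q) i) B"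
    using integral_multiple[OF assms(1,2)] by blast
  have "\<exists>T. T \<noteq> 0 \<and> degree T \<le> m \<and> (\<forall>x. poly (Polynomial.smult (of_int N) Q) x \<noteq> 0 \<longrightarrow>
      eval2 T x (poly (Polynomial.smult (of_int N) P) x / poly (Polynomial.smult (of_int N) Q) x) = 0)"
    using N assms(3) by (intro algebraic_relation) auto
  thus ?thesis using N(1) by simp
qed

text \<open>The relation for the constant function \<open>z\<close> is specialised at an integer
  where it does not vanish identically.\<close>

lemma K_algebraic:
  assumes "z \<in> K"
  shows "algebraic z" "alg_degree z \<le> m"
proof -
  have "\<exists>T. T \<noteq> 0 \<and> degree T \<le> m \<and> (\<forall>x. poly 1 x \<noteq> (0::real) \<longrightarrow> eval2 T x (poly [:z:] x / poly 1 x) = 0)"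
    using assms K_0 K_1 by (intro algebraic_relation_K) (auto simp: coeff_pCons split: nat.split)
  then obtain T where T: "T \<noteq> 0" "degree T \<le> m" "\<And>x. eval2 T x z = 0" by auto
  obtain x :: int where x: "map_poly (\<lambda>t. poly t x) T \<noteq> 0" using specialize_relation[OF T(1)] by blast
  let ?q = "map_poly (\<lambda>t. poly t x) T"
  have deg: "degree ?q \<le> m" using degree_map_poly_le T(2) order.trans by blast
  have "poly (of_int_poly ?q) z = eval2 T (of_int x) z"
    unfolding eval2_def by (simp add: map_poly_map_poly o_def)
  hence root: "poly (of_int_poly ?q) z = 0" using T(3) by simp
  show "algebraic z" using algebraicI_int[OF x root] .
  from algebraic_int_poly(5)[OF this x root] show "alg_degree z \<le> m" using deg by simp
qed

lemma simple_extension_subset_K: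
  assumes "z \<in> K"
  shows "simple_extension z \<subseteq> K"
proof
  fix w assume "w \<in> simple_extension z"
  then obtain p where "w = poly (map_poly of_rat p) z" by (rule simple_extensionE)
  thus "w \<in> K" using assms subfield_of_rat[OF subfield] by (auto intro!: poly_in_K simp: coeff_map_poly)
qed

text \<open>If \<open>T(x, F(x)) = 0\<close> is a relation that is separable at \<open>(r, F(r))\<close>, then the Taylor
  coefficients of \<open>F\<close> at \<open>r\<close> lie in \<open>\<rat>(F(r))\<close>, which by minimality of \<open>K\<close> must be all of \<open>K\<close>.\<close>

lemma alg_degree_value:
  fixes P Q :: "real poly"
  assumes deg: "field_degree K = m" and cf: "coefficient_field K (Fract P Q)"
    and PQ: "\<And>i. coeff P i \<in> K" "\<And>i. coeff Q i \<in> K" "Q \<noteq> 0"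
    and T: "\<And>x. poly Q x \<noteq> 0 \<Longrightarrow> eval2 T x (poly P x / poly Q x) = 0"
    and r: "poly Q (of_rat r) \<noteq> 0"
      "eval2 (pderiv T) (of_rat r) (poly P (of_rat r) / poly Q (of_rat r)) \<noteq> 0"
  shows "alg_degree (poly P (of_rat r) / poly Q (of_rat r)) = m"
proof -
  define \<alpha> where "\<alpha> = poly P (of_rat r) / poly Q (of_rat r)"
  have \<alpha>K: "\<alpha> \<in> K"
    unfolding \<alpha>_def using PQ subfield_of_rat[OF subfield]
    by (intro subfield_divide[OF subfield] poly_in_K) auto
  define L where "L = simple_extension \<alpha>"
  have LK: "L \<subseteq> K" using simple_extension_subset_K[OF \<alpha>K] by (simp add: L_def)
  have L: "is_subfield L"
    unfolding L_def using K_algebraic LK by (intro is_subfield_simple_extension) (auto simp: L_def)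
  have "\<alpha> = poly (map_poly of_rat [:0, 1:]) \<alpha>" by (simp add: hom_distribs)
  hence \<alpha>L: "\<alpha> \<in> L" unfolding L_def by (rule simple_extensionI)
  let ?s = "[:of_rat r, 1 :: real:]"
  let ?sh = "\<lambda>p. fps_of_poly (pcompose p ?s)"
  define f where "f = ?sh P * inverse (?sh Q)"
  have "fps_nth (?sh Q) 0 \<noteq> 0" using r(1) by (simp add: poly_pcompose flip: poly_0_coeff_0)
  hence f: "f * ?sh Q = ?sh P" by (simp add: f_def mult.assoc inverse_mult_eq_1)
  have shQ0: "?sh Q \<noteq> 0"
  proof
    assume "?sh Q = 0"
    hence "fps_nth (?sh Q) 0 = 0" by (simp only: fps_zero_nth)
    thus False using \<open>fps_nth (?sh Q) 0 \<noteq> 0\<close> by blast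
  qed
  have f0: "fps_nth f 0 = \<alpha>"
    by (simp add: f_def \<alpha>_def poly_pcompose divide_inverse flip: poly_0_coeff_0)
  define e where "e = degree T"
  define t where "t i = ?sh (of_int_poly (coeff T i))" for i
  have tL: "fps_nth (t i) n \<in> L" for i n
  proof -
    have "coeff ?s k \<in> L" for k
      by (auto simp: coeff_pCons subfield_0[OF L] subfield_1[OF L] subfield_of_rat[OF L] split: nat.split)
    thus ?thesis unfolding t_def fps_of_poly_nth
      by (intro coeffs_in_subfield_pcompose[OF L]) (auto simp: subfield_of_int[OF L])
  qed
  \<comment> \<open>Multiplying by a power of the shifted \<open>Q\<close> turns the sum into the
    shift of the homogenized relation, which is identically 0; the power is nonzero and
    cancels.\<close>
  have "?sh Q ^ e * (\<Sum>i\<le>e. t i * f ^ i) = (\<Sum>i\<le>e. t i * ?sh P ^ i * ?sh Q ^ (e - i))"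
    unfolding sum_distrib_left
  proof (intro sum.cong refl)
    fix i assume "i \<in> {..e}"
    hence "?sh Q ^ e = ?sh Q ^ i * ?sh Q ^ (e - i)" by (simp flip: power_add)
    thus "?sh Q ^ e * (t i * f ^ i) = t i * ?sh P ^ i * ?sh Q ^ (e - i)"
      unfolding f[symmetric] by (simp add: power_mult_distrib mult_ac)
  qed
  also have "\<dots> = ?sh (\<Sum>i\<le>e. of_int_poly (coeff T i) * P ^ i * Q ^ (e - i))"
    by (simp add: t_def pcompose_sum pcompose_mult pcompose_power fps_of_poly_sum fps_of_poly_mult fps_of_poly_power)
  also have "\<dots> = 0"
    using homogenized_eq_0[of T e Q P] PQ(3) T by (simp add: e_def)
  finally have root: "(\<Sum>i\<le>e. t i * f ^ i) = 0" using shQ0 by simp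
  have "(\<Sum>i\<le>e. of_nat i * fps_nth (t i) 0 * fps_nth f 0 ^ (i - 1)) = eval2 (pderiv T) (of_rat r) \<alpha>"
  proof (cases e)
    case 0
    hence "pderiv T = 0" by (simp add: pderiv_eq_0_iff e_def)
    thus ?thesis using 0 by (simp add: eval2_def)
  next
    case (Suc k)
    have t0: "fps_nth (t i) 0 = poly (of_int_poly (coeff T i)) (of_rat r)" for i
      by (simp add: t_def poly_pcompose flip: poly_0_coeff_0)
    have "degree (pderiv T) \<le> k" using Suc by (simp add: degree_pderiv e_def)
    hence "eval2 (pderiv T) (of_rat r) \<alpha> =
        (\<Sum>i\<le>k. of_nat (Suc i) * poly (of_int_poly (coeff T (Suc i))) (of_rat r) * \<alpha> ^ i)"
      by (simp add: eval2_eq_sum coeff_pderiv hom_distribs algebra_simps)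
    thus ?thesis unfolding Suc sum.atMost_Suc_shift by (simp add: t0 f0)
  qed
  hence simple: "(\<Sum>i\<le>e. of_nat i * fps_nth (t i) 0 * fps_nth f 0 ^ (i - 1)) \<noteq> 0"
    using r(2) by (simp add: \<alpha>_def)
  have "fps_nth f n \<in> L" for n
    using fps_root_in_subfield[OF L tL root simple] f0 \<alpha>L by simp
  hence "ratfun_over L (Fract P Q)"
    using ratfun_over_if_taylor_in_subfield[OF L subfield_of_rat[OF L] PQ(3) f] by blast
  hence "L = K" using cf L LK unfolding coefficient_field_def by blast
  hence "m \<le> alg_degree \<alpha>"
    using dim_simple_extension_le[OF K_algebraic(1)[OF \<alpha>K]] deg by (simp add: L_def)
  thus ?thesis using K_algebraic(2)[OF \<alpha>K] by (simp add: \<alpha>_def)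
qed

lemma finite_exceptional_points:
  fixes P Q :: "real poly"
  assumes deg: "field_degree K = m" and cf: "coefficient_field K (Fract P Q)"
    and PQ: "\<And>i. coeff P i \<in> K" "\<And>i. coeff Q i \<in> K" "Q \<noteq> 0"
  shows "finite {r. poly Q (of_rat r) = 0 \<or> alg_degree (poly P (of_rat r) / poly Q (of_rat r)) \<noteq> m}"
proof -
  obtain T where T: "\<And>x. poly Q x \<noteq> 0 \<Longrightarrow> eval2 T x (poly P x / poly Q x) = 0"
    "finite {x. poly Q x \<noteq> 0 \<and> eval2 (pderiv T) x (poly P x / poly Q x) = 0}"
    using separable_relation[OF PQ(3), of P] algebraic_relation_K[OF PQ] by blast
  have "finite {x. poly Q x = 0 \<or> (poly Q x \<noteq> 0 \<and> eval2 (pderiv T) x (poly P x / poly Q x) = 0)}"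
    using poly_roots_finite[OF PQ(3)] T(2) by (simp add: Collect_disj_eq)
  from finite_rat_if_finite_real[OF this] show ?thesis
    by (rule rev_finite_subset) (use alg_degree_value[OF deg cf PQ T(1)] in auto)
qed

end

subsection \<open>Heights\<close>

lemma finite_height_set: "finite {\<bar>coeff p i\<bar> | i. i \<le> degree p}"
  for p :: "int poly"
  by (rule finite_surj[of "{..degree p}" _ "\<lambda>i. \<bar>coeff p i\<bar>"]) auto

lemma height_ge_1:
  assumes "algebraic \<alpha>"
  shows "height \<alpha> \<ge> 1"
proof -
  have "\<bar>lead_coeff (int_minpoly \<alpha>)\<bar> \<le> height \<alpha>"
    unfolding height_def by (rule Max_ge[OF finite_height_set]) auto
  thus ?thesis using algebraic_int_poly(3)[OF assms] by linarith
qed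

lemma coeff_le_height:
  assumes "algebraic \<alpha>"
  shows "\<bar>coeff (int_minpoly \<alpha>) i\<bar> \<le> height \<alpha>"
proof (cases "i \<le> degree (int_minpoly \<alpha>)")
  case True
  thus ?thesis unfolding height_def by (intro Max_ge[OF finite_height_set]) auto
next
  case False
  thus ?thesis using height_ge_1[OF assms] by (simp add: coeff_eq_0)
qed

lemma height_le_if_coeff_le:
  assumes "\<And>i. real_of_int \<bar>coeff (int_minpoly \<alpha>) i\<bar> \<le> B"
  shows "real_of_int (height \<alpha>) \<le> B"
proof -
  have "height \<alpha> \<in> {\<bar>coeff (int_minpoly \<alpha>) i\<bar> | i. i \<le> degree (int_minpoly \<alpha>)}"
    unfolding height_def by (rule Max_in[OF finite_height_set]) auto
  thus ?thesis using assms by auto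
qed

text \<open>An annihilator of minimal degree is an integral multiple of the minimal polynomial,
  so the latter has the smaller coefficients.\<close>

lemma height_le_annihilator:
  fixes G :: "int poly"
  assumes alg: "algebraic \<alpha>" and G: "G \<noteq> 0" "poly (of_int_poly G) \<alpha> = 0" "degree G \<le> alg_degree \<alpha>"
    and B: "\<And>i. real_of_int \<bar>coeff G i\<bar> \<le> B"
  shows "real_of_int (height \<alpha>) \<le> B"
proof (rule height_le_if_coeff_le)
  fix i
  define p where "p = int_minpoly \<alpha>"
  note p = algebraic_int_poly[OF alg, folded p_def]
  have deg: "degree G = degree p"
    using p(5)[OF G(1,2)] G(3) by (simp add: alg_degree_def p_def)
  \<comment> \<open>The leading terms cancel, so a nonzero \<open>R\<close> would annihilate
    \<open>\<alpha>\<close> in degree below the minimal one.\<close>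
  define R where "R = Polynomial.smult (lead_coeff p) G - Polynomial.smult (lead_coeff G) p"
  have "R = 0"
  proof (rule ccontr)
    assume R: "R \<noteq> 0"
    have "poly (of_int_poly R) \<alpha> = 0"
      using p(2) G(2) by (simp add: R_def hom_distribs)
    hence "degree p \<le> degree R" using p(5)[OF R] by (simp add: alg_degree_def p_def)
    moreover have "degree R \<le> degree p"
      unfolding R_def by (rule degree_diff_le) (use deg in \<open>simp_all add: degree_smult_le\<close>)
    ultimately have "coeff R (degree p) \<noteq> 0" using R by (metis le_antisym leading_coeff_0_iff)
    thus False by (simp add: R_def deg mult.commute)
  qed
  hence eq: "Polynomial.smult (lead_coeff p) G = Polynomial.smult (lead_coeff G) p" by (simp add: R_def)
  hence "content (Polynomial.smult (lead_coeff p) G) = content (Polynomial.smult (lead_coeff G) p)"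
    by simp
  \<comment> \<open>As \<open>p\<close> is primitive with positive leading coefficient, comparing
    contents identifies the ratio of \<open>G\<close> to \<open>p\<close>, up to sign, as the
    integer \<open>content G\<close>.\<close>
  hence cont: "lead_coeff p * content G = \<bar>lead_coeff G\<bar>"
    using p(3,4) by simp
  have "lead_coeff p * coeff G i = lead_coeff G * coeff p i"
    using arg_cong[OF eq, of "\<lambda>p. coeff p i"] by simp
  hence "lead_coeff p * \<bar>coeff G i\<bar> = \<bar>lead_coeff G\<bar> * \<bar>coeff p i\<bar>"
    using p(3) by (metis abs_mult abs_of_pos)
  also have "\<dots> = lead_coeff p * (content G * \<bar>coeff p i\<bar>)"
    by (simp flip: cont)
  finally have "\<bar>coeff G i\<bar> = content G * \<bar>coeff p i\<bar>" using p(1,3) by auto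
  moreover have "content G \<ge> 1"
    using cont p(3) G(1) by (metis abs_ge_zero int_one_le_iff_zero_less leading_coeff_0_iff
        less_le mult_zero_right zero_le_mult_iff zero_less_abs_iff not_less)
  hence "1 * \<bar>coeff p i\<bar> \<le> content G * \<bar>coeff p i\<bar>" by (intro mult_right_mono) auto
  ultimately have "\<bar>coeff p i\<bar> \<le> \<bar>coeff G i\<bar>" by simp
  hence "real_of_int \<bar>coeff p i\<bar> \<le> real_of_int \<bar>coeff G i\<bar>" by (simp only: of_int_le_iff)
  thus "real_of_int \<bar>coeff (int_minpoly \<alpha>) i\<bar> \<le> B" using B[of i] by (simp add: p_def)
qed

text \<open>Northcott finiteness: degree and height leave finitely many minimal polynomials, each
  with finitely many roots.\<close>

lemma finite_bounded_height:
  "finite {\<alpha>. algebraic \<alpha> \<and> alg_degree \<alpha> = n \<and> real_of_int (height \<alpha>) \<le> X}"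
proof -
  define S where "S = {p :: int poly. p \<noteq> 0 \<and> degree p \<le> n \<and> (\<forall>i. coeff p i \<in> {- \<lfloor>X\<rfloor>..\<lfloor>X\<rfloor>})}"
  have "S \<subseteq> Poly ` {xs. set xs \<subseteq> {- \<lfloor>X\<rfloor>..\<lfloor>X\<rfloor>} \<and> length xs \<le> Suc n}"
  proof
    fix p assume p: "p \<in> S"
    have "p = Poly (coeffs p)" by simp
    moreover have "set (coeffs p) \<subseteq> {- \<lfloor>X\<rfloor>..\<lfloor>X\<rfloor>}" "length (coeffs p) \<le> Suc n"
      using p by (auto simp: S_def coeffs_def)
    ultimately show "p \<in> Poly ` {xs. set xs \<subseteq> {- \<lfloor>X\<rfloor>..\<lfloor>X\<rfloor>} \<and> length xs \<le> Suc n}" by blast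
  qed
  hence "finite S" using finite_lists_length_le[of "{- \<lfloor>X\<rfloor>..\<lfloor>X\<rfloor>}" "Suc n"] by (blast intro: finite_subset)
  moreover have "finite {\<alpha> :: real. poly (of_int_poly p) \<alpha> = 0}" if "p \<in> S" for p
    using that by (intro poly_roots_finite) (auto simp: S_def)
  ultimately have fin: "finite (\<Union>p\<in>S. {\<alpha> :: real. poly (of_int_poly p) \<alpha> = 0})" by blast
  have "\<alpha> \<in> (\<Union>p\<in>S. {\<alpha> :: real. poly (of_int_poly p) \<alpha> = 0})"
    if \<alpha>: "algebraic \<alpha>" "alg_degree \<alpha> = n" "real_of_int (height \<alpha>) \<le> X" for \<alpha>
  proof -
    have "coeff (int_minpoly \<alpha>) i \<in> {- \<lfloor>X\<rfloor>..\<lfloor>X\<rfloor>}" for i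
    proof -
      have "\<bar>coeff (int_minpoly \<alpha>) i\<bar> \<le> \<lfloor>X\<rfloor>"
        using coeff_le_height[OF \<alpha>(1), of i] \<alpha>(3) by linarith
      thus ?thesis by auto
    qed
    hence "int_minpoly \<alpha> \<in> S"
      using algebraic_int_poly(1)[OF \<alpha>(1)] \<alpha>(2) by (simp add: S_def alg_degree_def)
    thus ?thesis using algebraic_int_poly(2)[OF \<alpha>(1)] by blast
  qed
  thus ?thesis by (intro rev_finite_subset[OF fin] subsetI) simp
qed

lemma height_rational:
  fixes p q :: int
  assumes "coprime p q" "q > 0"
  shows "height (of_int p / of_int q) = max \<bar>p\<bar> q"
proof -
  define \<alpha> where "\<alpha> = (of_int p / of_int q :: real)"
  have "is_int_minpoly [:- p, q:] \<alpha>"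
    unfolding is_int_minpoly_def
  proof (intro conjI allI impI)
    show "poly (of_int_poly [:- p, q:]) \<alpha> = 0" using assms(2) by (simp add: \<alpha>_def hom_distribs)
    show "content [:- p, q:] = 1"
      using assms by (simp add: content_def)
    fix g :: "int poly" assume g: "g \<noteq> 0" "poly (of_int_poly g) \<alpha> = 0"
    have "degree g \<noteq> 0"
    proof
      assume "degree g = 0"
      then obtain c where "g = [:c:]" using degree_eq_zeroE by blast
      thus False using g by (simp add: hom_distribs)
    qed
    thus "degree [:- p, q:] \<le> degree g" by simp
  qed (use assms in auto)
  hence "int_minpoly \<alpha> = [:- p, q:]"
    unfolding int_minpoly_def using is_int_minpoly_unique by blast
  moreover have "{\<bar>coeff [:- p, q:] i\<bar> | i. i \<le> degree [:- p, q:]} = {\<bar>p\<bar>, q}"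
  proof -
    have "{i. i \<le> degree [:- p, q:]} = {0, 1}" using assms(2) by auto
    hence "{\<bar>coeff [:- p, q:] i\<bar> | i. i \<le> degree [:- p, q:]} = (\<lambda>i. \<bar>coeff [:- p, q:] i\<bar>) ` {0, 1}"
      by blast
    thus ?thesis using assms(2) by simp
  qed
  ultimately show ?thesis by (simp add: height_def \<alpha>_def)
qed

subsection \<open>Homogenized evaluation at rational points\<close>

text \<open>This is \<open>q ^ d * poly P (p / q)\<close> without division, hence an integer for
  integral data. \<open>d\<close> may exceed the degree, so that several polynomials can share one
  power of \<open>q\<close>.\<close>

definition hom_eval :: "nat \<Rightarrow> 'a::comm_ring_1 poly \<Rightarrow> 'a \<Rightarrow> 'a \<Rightarrow> 'a" where
  "hom_eval d P p q = (\<Sum>i\<le>d. coeff P i * p ^ i * q ^ (d - i))"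

lemma hom_eval_eq:
  fixes P :: "'a::field poly"
  assumes "degree P \<le> d" "q \<noteq> 0"
  shows "hom_eval d P p q = q ^ d * poly P (p / q)"
  unfolding hom_eval_def poly_eq_sum[OF assms(1)] sum_distrib_left using assms(2)
  by (intro sum.cong) (auto simp: field_simps simp flip: power_add)

lemma hom_eval_of_int:
  "hom_eval d (of_int_poly t) (of_int p) (of_int q) = of_int (hom_eval d t p q)"
  by (simp add: hom_eval_def)

text \<open>In the unit interval the denominator alone measures the size of all monomials.\<close>

lemma abs_monomial_le:
  fixes p q :: real
  assumes "\<bar>p\<bar> \<le> q" "i \<le> d"
  shows "\<bar>p ^ i * q ^ (d - i)\<bar> \<le> q ^ d"
proof -
  have "\<bar>p ^ i * q ^ (d - i)\<bar> = \<bar>p\<bar> ^ i * q ^ (d - i)" using assms(1) by (simp add: abs_mult power_abs)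
  also have "\<dots> \<le> q ^ i * q ^ (d - i)" using assms(1) by (intro mult_right_mono power_mono) auto
  also have "\<dots> = q ^ d" using assms(2) by (simp flip: power_add)
  finally show ?thesis .
qed

lemma abs_hom_eval_le:
  fixes p q :: real
  assumes "\<bar>p\<bar> \<le> q"
  shows "\<bar>hom_eval d P p q\<bar> \<le> (\<Sum>i\<le>d. \<bar>coeff P i\<bar>) * q ^ d"
proof -
  have "\<bar>hom_eval d P p q\<bar> \<le> (\<Sum>i\<le>d. \<bar>coeff P i * p ^ i * q ^ (d - i)\<bar>)"
    unfolding hom_eval_def by (rule sum_abs)
  also have "\<dots> \<le> (\<Sum>i\<le>d. \<bar>coeff P i\<bar> * q ^ d)"
  proof (rule sum_mono)
    fix i assume "i \<in> {..d}"
    hence "\<bar>coeff P i\<bar> * \<bar>p ^ i * q ^ (d - i)\<bar> \<le> \<bar>coeff P i\<bar> * q ^ d"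
      using abs_monomial_le[OF assms] by (intro mult_left_mono) auto
    thus "\<bar>coeff P i * p ^ i * q ^ (d - i)\<bar> \<le> \<bar>coeff P i\<bar> * q ^ d" by (simp add: abs_mult mult.assoc)
  qed
  finally show ?thesis by (simp add: sum_distrib_right)
qed

text \<open>Specialising \<open>T\<close> at p / q and multiplying by \<open>q ^ D\<close> gives an
  integral polynomial \<open>G\<close> with root \<open>\<alpha>\<close> and coefficients of order
  \<open>q ^ D\<close>. As \<open>\<alpha>\<close> has degree exactly \<open>m\<close>,
  \<open>G\<close> has minimal degree and \<open>height_le_annihilator\<close> applies.
  \<open>S\<close> consists of the roots of one nonzero coefficient of \<open>T\<close>, which keeps
  \<open>G\<close> nonzero.\<close>

lemma height_value_le:
  fixes P Q :: "real poly"
  assumes T: "T \<noteq> 0" "degree T \<le> m" "\<And>x. poly Q x \<noteq> 0 \<Longrightarrow> eval2 T x (poly P x / poly Q x) = 0"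
  shows "\<exists>C D S. finite S \<and> (\<forall>(p::int) (q::int) r \<alpha>. r = of_int p / of_int q \<longrightarrow> r \<notin> S \<longrightarrow>
    0 \<le> p \<longrightarrow> p \<le> q \<longrightarrow> 0 < q \<longrightarrow> poly Q r \<noteq> 0 \<longrightarrow> \<alpha> = poly P r / poly Q r \<longrightarrow>
    algebraic \<alpha> \<longrightarrow> alg_degree \<alpha> = m \<longrightarrow> real_of_int (height \<alpha>) \<le> C * of_int q ^ D)"
proof -
  obtain i0 where i0: "coeff T i0 \<noteq> 0" using T(1) by (metis leading_coeff_0_iff)
  have i0m: "i0 \<le> m" using i0 T(2) by (metis le_degree order.trans)
  define D where "D = Max ((\<lambda>i. degree (coeff T i)) ` {..m})"
  have D: "degree (coeff T i) \<le> D" if "i \<le> m" for i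
    unfolding D_def using that by (intro Max_ge) auto
  define c where "c i = (\<Sum>k\<le>D. \<bar>real_of_int (coeff (coeff T i) k)\<bar>)" for i
  define C where "C = (\<Sum>i\<le>m. c i)"
  have c0: "c i \<ge> 0" for i by (auto simp: c_def intro: sum_nonneg)
  have main: "real_of_int (height \<alpha>) \<le> C * of_int q ^ D"
    if pq: "0 \<le> p" "p \<le> q" "0 < q" and r: "r = of_int p / of_int q" "poly (of_int_poly (coeff T i0)) r \<noteq> 0"
      "poly Q r \<noteq> 0" and \<alpha>: "\<alpha> = poly P r / poly Q r" "algebraic \<alpha>" "alg_degree \<alpha> = m"
    for p q :: int and r \<alpha> :: real
  proof -
    define G where "G = (\<Sum>i\<le>m. monom (hom_eval D (coeff T i) p q) i)"
    have G: "coeff G i = (if i \<le> m then hom_eval D (coeff T i) p q else 0)" for i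
      unfolding G_def by (simp add: coeff_sum coeff_monom if_distrib cong: if_cong)
    have he: "real_of_int (hom_eval D (coeff T i) p q) = of_int q ^ D * poly (of_int_poly (coeff T i)) r"
      if "i \<le> m" for i
      unfolding r(1) hom_eval_of_int[symmetric] using pq D[OF that] by (intro hom_eval_eq) auto
    have degG: "degree G \<le> m" by (rule degree_le) (simp add: G)
    have "real_of_int (coeff G i0) \<noteq> 0" using he[OF i0m] r(2) pq i0m by (simp add: G)
    hence "G \<noteq> 0" by auto
    moreover have "poly (of_int_poly G) \<alpha> = of_int q ^ D * eval2 T r \<alpha>"
      unfolding eval2_eq_sum[OF T(2)] sum_distrib_left
      by (subst poly_eq_sum[of _ m]) (auto simp: degG G he mult.assoc)
    hence "poly (of_int_poly G) \<alpha> = 0" using T(3)[OF r(3)] \<alpha>(1) by simp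
    moreover have "real_of_int \<bar>coeff G i\<bar> \<le> C * of_int q ^ D" for i
    proof (cases "i \<le> m")
      case True
      have "\<bar>real_of_int (hom_eval D (coeff T i) p q)\<bar> \<le> c i * of_int q ^ D"
        using abs_hom_eval_le[of "of_int p" "of_int q" D "of_int_poly (coeff T i)"] pq
        by (simp add: hom_eval_of_int c_def)
      also have "\<dots> \<le> C * of_int q ^ D"
        unfolding C_def using True c0 pq by (intro mult_right_mono member_le_sum) auto
      finally show ?thesis using True by (simp add: G)
    next
      case False
      thus ?thesis using pq c0 by (simp add: G C_def sum_nonneg)
    qed
    ultimately show ?thesis using degG \<alpha> by (intro height_le_annihilator[of \<alpha> G]) auto
  qed
  have "finite {r::real. poly (of_int_poly (coeff T i0)) r = 0}"
    using i0 by (intro poly_roots_finite) simp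
  thus ?thesis
    using main by (intro exI[of _ C] exI[of _ D] exI[of _ "{r. poly (of_int_poly (coeff T i0)) r = 0}"]) simp
qed

subsection \<open>A Liouville inequality\<close>

context number_basis
begin

lemma rep_hom_eval:
  fixes p q :: int
  assumes B: "\<And>i. rep (coeff P i) B" and pq: "0 \<le> p" "p \<le> q"
  shows "rep (hom_eval d P (of_int p) (of_int q)) (real (Suc d) * B * of_int q ^ d)"
proof -
  have "rep (\<Sum>i\<le>d. coeff P i * of_int p ^ i * of_int q ^ (d - i)) (\<Sum>i\<le>d. of_int q ^ d * B)"
  proof (rule rep_sum)
    fix i assume i: "i \<in> {..d}"
    have "real_of_int \<bar>p ^ i * q ^ (d - i)\<bar> \<le> of_int q ^ d"
      using abs_monomial_le[of "of_int p" "of_int q" i d] i pq by simp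
    hence "rep (of_int (p ^ i * q ^ (d - i)) * coeff P i) (of_int q ^ d * B)"
      by (intro rep_mono[OF rep_scale[OF B]] mult_right_mono rep_nonneg[OF B])
    thus "rep (coeff P i * of_int p ^ i * of_int q ^ (d - i)) (of_int q ^ d * B)"
      by (simp add: mult_ac)
  qed
  thus ?thesis by (simp add: hom_eval_def mult_ac)
qed

text \<open>With \<open>hP\<close> and \<open>hQ\<close> the homogenized values,
  \<open>hQ ^ n\<close> times g(hP / hQ) is an integral combination of monomials in
  \<open>hP\<close> and \<open>hQ\<close>. It therefore has a matrix with entries of order
  \<open>H * q ^ (d * n)\<close>, and \<open>rep_lower_bound\<close> keeps it away from 0. The
  constants depend neither on the point nor on \<open>g\<close>.\<close>

lemma liouville_inequality_integral:
  fixes P Q :: "real poly"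
  assumes PQ: "\<And>i. rep (coeff P i) B" "\<And>i. rep (coeff Q i) B"
  shows "\<exists>C D. \<forall>(p::int) (q::int) g H. 0 \<le> p \<longrightarrow> p \<le> q \<longrightarrow> 0 < q \<longrightarrow> poly Q (of_int p / of_int q) \<noteq> 0 \<longrightarrow>
    degree g \<le> n \<longrightarrow> (\<forall>i. real_of_int \<bar>coeff g i\<bar> \<le> H) \<longrightarrow>
    poly (of_int_poly g) (poly P (of_int p / of_int q) / poly Q (of_int p / of_int q)) \<noteq> 0 \<longrightarrow>
    1 \<le> C * \<bar>poly (of_int_poly g) (poly P (of_int p / of_int q) / poly Q (of_int p / of_int q))\<bar>
        * H ^ (m - 1) * of_int q ^ D"
proof -
  obtain \<kappa> where \<kappa>: "\<kappa> > 0" "\<And>z B. rep z B \<Longrightarrow> z \<noteq> 0 \<Longrightarrow> 1 \<le> \<kappa> * \<bar>z\<bar> * B ^ (m - 1)"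
    using rep_lower_bound by blast
  define d where "d = max (degree P) (degree Q)"
  \<comment> \<open>There are \<open>n + 1\<close> summands; one \<open>m\<close> comes from
    multiplying two powers, one more from each factor of a power, and \<open>(d + 1) * B\<close>
    from \<open>rep_hom_eval\<close>.\<close>
  define E where "E = real (Suc n) * real m * (real m * real (Suc d) * B) ^ n"
  define S where "S = (\<Sum>i\<le>d. \<bar>coeff Q i\<bar>)"
  define C where "C = \<kappa> * S ^ n * E ^ (m - 1)"
  \<comment> \<open>\<open>d * n\<close> comes from the upper bound for \<open>hQ ^ n\<close>, the
    other summand from the matrix entries raised to the power \<open>m - 1\<close>.\<close>
  define D where "D = d * n + d * n * (m - 1)"
  have B0: "B \<ge> 0" using rep_nonneg[OF PQ(1)] .
  have "1 \<le> C * \<bar>poly (of_int_poly g) \<alpha>\<bar> * H ^ (m - 1) * of_int q ^ D"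
    if pq: "0 \<le> p" "p \<le> q" "0 < q" and r: "r = of_int p / of_int q" "poly Q r \<noteq> 0"
      and g: "degree g \<le> n" "\<And>i. real_of_int \<bar>coeff g i\<bar> \<le> H" "poly (of_int_poly g) \<alpha> \<noteq> 0"
      and \<alpha>: "\<alpha> = poly P r / poly Q r"
    for p q :: int and g H r \<alpha>
  proof -
    define hP where "hP = hom_eval d P (of_int p) (of_int q)"
    define hQ where "hQ = hom_eval d Q (of_int p) (of_int q)"
    define A where "A = real (Suc d) * B * of_int q ^ d"
    have H0: "H \<ge> 0" using g(2)[of 0] by linarith
    have A0: "A \<ge> 0" using B0 pq by (simp add: A_def)
    have rep: "rep hP A" "rep hQ A"
      unfolding hP_def hQ_def A_def using PQ pq by (intro rep_hom_eval; simp)+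
    have hPeq: "hP = of_int q ^ d * poly P r" and hQeq: "hQ = of_int q ^ d * poly Q r"
      unfolding hP_def hQ_def r(1) using pq by (intro hom_eval_eq; simp add: d_def)+
    have hQ0: "hQ \<noteq> 0" using hQeq r(2) pq by simp
    have \<alpha>': "\<alpha> = hP / hQ" using hPeq hQeq \<alpha> pq by simp
    define \<mu> where "\<mu> = (\<Sum>i\<le>n. of_int (coeff g i) * (hP ^ i * hQ ^ (n - i)))"
    have \<mu>: "\<mu> = hQ ^ n * poly (of_int_poly g) \<alpha>"
      unfolding \<mu>_def using hQ0 g(1)
      by (subst poly_eq_sum[of _ n])
        (auto simp: \<alpha>' sum_distrib_left field_simps simp flip: power_add intro!: sum.cong)
    have "rep \<mu> (\<Sum>i\<le>n. H * (real m * (real m * A) ^ n))"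
      unfolding \<mu>_def
    proof (rule rep_sum)
      fix i assume "i \<in> {..n}"
      hence i: "(real m * A) ^ i * (real m * A) ^ (n - i) = (real m * A) ^ n" by (simp flip: power_add)
      have "rep (hP ^ i * hQ ^ (n - i)) (real m * (real m * A) ^ n)"
        using rep_mult[OF rep_power[OF rep(1), of i] rep_power[OF rep(2), of "n - i"]]
        by (simp only: mult.assoc i)
      from rep_scale[OF this, of "coeff g i"]
      show "rep (of_int (coeff g i) * (hP ^ i * hQ ^ (n - i))) (H * (real m * (real m * A) ^ n))"
        by (rule rep_mono) (use A0 g(2) in \<open>intro mult_right_mono, auto\<close>)
    qed
    also have "(\<Sum>i\<le>n. H * (real m * (real m * A) ^ n)) = E * H * of_int q ^ (d * n)"
      by (simp add: E_def A_def power_mult_distrib power_mult mult_ac del: of_nat_Suc)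
    finally have rep\<mu>: "rep \<mu> (E * H * of_int q ^ (d * n))" .
    have "\<mu> \<noteq> 0" using \<mu> hQ0 g(3) by simp
    from \<kappa>(2)[OF rep\<mu> this]
    have 1: "1 \<le> \<kappa> * \<bar>\<mu>\<bar> * (E * H * of_int q ^ (d * n)) ^ (m - 1)" .
    have E0: "E \<ge> 0" using B0 by (simp add: E_def)
    have "\<bar>hQ\<bar> \<le> S * of_int q ^ d"
      unfolding hQ_def S_def using pq by (intro abs_hom_eval_le) simp
    hence "\<bar>hQ\<bar> ^ n \<le> (S * of_int q ^ d) ^ n" by (rule power_mono) simp
    hence "\<bar>\<mu>\<bar> \<le> (S * of_int q ^ d) ^ n * \<bar>poly (of_int_poly g) \<alpha>\<bar>"
      unfolding \<mu> by (simp add: abs_mult power_abs mult_right_mono)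
    hence "\<kappa> * \<bar>\<mu>\<bar> * (E * H * of_int q ^ (d * n)) ^ (m - 1)
        \<le> \<kappa> * ((S * of_int q ^ d) ^ n * \<bar>poly (of_int_poly g) \<alpha>\<bar>) * (E * H * of_int q ^ (d * n)) ^ (m - 1)"
      using \<kappa>(1) E0 H0 pq by (intro mult_right_mono mult_left_mono) auto
    also have "\<dots> = C * \<bar>poly (of_int_poly g) \<alpha>\<bar> * H ^ (m - 1) * of_int q ^ D"
    proof -
      have "(of_int q :: real) ^ D = of_int q ^ (d * n) * (of_int q ^ (d * n)) ^ (m - 1)"
        by (simp only: D_def power_add power_mult)
      moreover have "(S * of_int q ^ d) ^ n = S ^ n * of_int q ^ (d * n)"
        by (simp add: power_mult_distrib power_mult)
      ultimately show ?thesis by (simp only: C_def power_mult_distrib mult_ac)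
    qed
    finally show ?thesis using 1 by linarith
  qed
  thus ?thesis by (intro exI[of _ C] exI[of _ D]) blast
qed

lemma liouville_inequality:
  fixes P Q :: "real poly"
  assumes "\<And>i. coeff P i \<in> K" "\<And>i. coeff Q i \<in> K"
  shows "\<exists>C D. \<forall>(p::int) (q::int) g H. 0 \<le> p \<longrightarrow> p \<le> q \<longrightarrow> 0 < q \<longrightarrow> poly Q (of_int p / of_int q) \<noteq> 0 \<longrightarrow>
    degree g \<le> n \<longrightarrow> (\<forall>i. real_of_int \<bar>coeff g i\<bar> \<le> H) \<longrightarrow>
    poly (of_int_poly g) (poly P (of_int p / of_int q) / poly Q (of_int p / of_int q)) \<noteq> 0 \<longrightarrow>
    1 \<le> C * \<bar>poly (of_int_poly g) (poly P (of_int p / of_int q) / poly Q (of_int p / of_int q))\<bar>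
        * H ^ (m - 1) * of_int q ^ D"
proof -
  obtain N :: int and B where N: "N > 0"
    "\<And>i. rep (coeff (Polynomial.smult (of_int N) P) i) B"
    "\<And>i. rep (coeff (Polynomial.smult (of_int N) Q) i) B"
    using integral_multiple[OF assms] by blast
  have "poly (Polynomial.smult (of_int N) P) x / poly (Polynomial.smult (of_int N) Q) x
      = poly P x / poly Q x" "poly (Polynomial.smult (of_int N) Q) x \<noteq> 0 \<longleftrightarrow> poly Q x \<noteq> 0" for x
    using N(1) by simp_all
  thus ?thesis using liouville_inequality_integral[OF N(2,3), of n] by (simp only:)
qed

end

subsection \<open>Rapid rational approximation\<close>

text \<open>The bound on the values is carried through the induction because the difference of two
  products needs it.\<close>

lemma poly_lipschitz:
  fixes p :: "real poly"
  shows "\<exists>C\<ge>0. \<forall>x y. \<bar>x\<bar> \<le> M \<longrightarrow> \<bar>y\<bar> \<le> M \<longrightarrow> \<bar>poly p x\<bar> \<le> C \<and> \<bar>poly p x - poly p y\<bar> \<le> C * \<bar>x - y\<bar>"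
proof (induction p)
  case 0
  show ?case by (intro exI[of _ 0]) simp
next
  case (pCons a p)
  then obtain C where C: "C \<ge> 0" "\<And>x. \<bar>x\<bar> \<le> M \<Longrightarrow> \<bar>poly p x\<bar> \<le> C"
    "\<And>x y. \<bar>x\<bar> \<le> M \<Longrightarrow> \<bar>y\<bar> \<le> M \<Longrightarrow> \<bar>poly p x - poly p y\<bar> \<le> C * \<bar>x - y\<bar>" by blast
  define C' where "C' = \<bar>a\<bar> + \<bar>M\<bar> * C + C"
  have "\<bar>poly (pCons a p) x\<bar> \<le> C'" if "\<bar>x\<bar> \<le> M" for x
  proof -
    have "\<bar>x\<bar> * \<bar>poly p x\<bar> \<le> \<bar>M\<bar> * C" using that C(2) by (intro mult_mono) auto
    thus ?thesis using C(1) abs_triangle_ineq[of a "x * poly p x"] by (simp add: C'_def abs_mult)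
  qed
  moreover have "\<bar>poly (pCons a p) x - poly (pCons a p) y\<bar> \<le> C' * \<bar>x - y\<bar>"
    if "\<bar>x\<bar> \<le> M" "\<bar>y\<bar> \<le> M" for x y
  proof -
    have "poly (pCons a p) x - poly (pCons a p) y = x * (poly p x - poly p y) + (x - y) * poly p y"
      by (simp add: algebra_simps)
    also have "\<bar>\<dots>\<bar> \<le> \<bar>x\<bar> * \<bar>poly p x - poly p y\<bar> + \<bar>x - y\<bar> * \<bar>poly p y\<bar>"
      by (metis abs_mult abs_triangle_ineq)
    also have "\<dots> \<le> \<bar>M\<bar> * (C * \<bar>x - y\<bar>) + \<bar>x - y\<bar> * C"
      using that C by (intro add_mono mult_mono) auto
    also have "\<dots> = (\<bar>M\<bar> * C + C) * \<bar>x - y\<bar>" by (simp add: algebra_simps)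
    also have "\<dots> \<le> C' * \<bar>x - y\<bar>" by (intro mult_right_mono) (simp_all add: C'_def)
    finally show ?thesis .
  qed
  moreover have "C' \<ge> 0" using C(1) by (simp add: C'_def)
  ultimately show ?case by blast
qed

text \<open>\<open>close\<close> and \<open>growth\<close> together make the error smaller than any
  fixed power of \<open>1 / q k\<close>. \<open>inj\<close> turns finitely many exceptional points
  into finitely many exceptional indices.\<close>

locale rapid_approximation =
  fixes \<xi> :: real and p q :: "nat \<Rightarrow> int"
  assumes q_pos: "0 < q k" and p_nonneg: "0 \<le> p k" and p_le: "p k \<le> q k"
    and close: "\<bar>\<xi> - of_int (p k) / of_int (q k)\<bar> \<le> 2 / of_int (q (Suc k))"
    and inj: "inj (\<lambda>k. of_int (p k) / of_int (q k) :: rat)"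
    and growth: "\<forall>\<^sub>F k in sequentially. real_of_int (q k) ^ S \<le> of_int (q (Suc k))"
    and q_large: "\<forall>\<^sub>F k in sequentially. X \<le> real_of_int (q k)"
begin

abbreviation x :: "nat \<Rightarrow> real" where "x k \<equiv> of_int (p k) / of_int (q k)"

lemma q_ge_1: "1 \<le> real_of_int (q k)"
  using q_pos[of k] by simp

lemma x_bounded: "\<bar>x k\<bar> \<le> 1"
  using q_pos[of k] p_nonneg[of k] p_le[of k] by simp

text \<open>One further power of \<open>q k\<close>, which tends to infinity, absorbs the
  constant.\<close>

lemma growth_strict: "\<forall>\<^sub>F k in sequentially. C * real_of_int (q k) ^ S < of_int (q (Suc k))"
  using growth[of "Suc S"] q_large[of "C + 1"]
proof eventually_elim
  case (elim k)
  have "C * real_of_int (q k) ^ S < (C + 1) * real_of_int (q k) ^ S" using q_pos[of k] by simp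
  also have "\<dots> \<le> real_of_int (q k) * real_of_int (q k) ^ S"
    using elim(2) q_pos[of k] by (intro mult_right_mono) auto
  finally show ?case using elim(1) by simp
qed

lemma x_tendsto: "x \<longlonglongrightarrow> \<xi>"
proof (rule LIMSEQ_I)
  fix e :: real assume e: "e > 0"
  have "\<forall>\<^sub>F k in sequentially. 2 / e * real_of_int (q k) ^ 0 < of_int (q (Suc k))" by (rule growth_strict)
  hence "\<forall>\<^sub>F k in sequentially. norm (x k - \<xi>) < e"
  proof eventually_elim
    case (elim k)
    hence "2 / of_int (q (Suc k)) < e" using e q_pos[of "Suc k"] by (simp add: field_simps)
    thus ?case using close[of k] by (simp add: abs_minus_commute)
  qed
  thus "\<exists>no. \<forall>n\<ge>no. norm (x n - \<xi>) < e" by (simp add: eventually_sequentially)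
qed

lemma eventually_not_rat:
  assumes "finite {r::rat. R r}"
  shows "\<forall>\<^sub>F k in sequentially. \<not> R (of_int (p k) / of_int (q k))"
proof -
  have "finite {k. R (of_int (p k) / of_int (q k))}"
    using finite_vimageI[OF assms inj] by (simp add: vimage_def)
  thus ?thesis by (simp add: eventually_cofinite flip: cofinite_eq_sequentially)
qed

lemma eventually_not_real:
  assumes "finite {r::real. R r}"
  shows "\<forall>\<^sub>F k in sequentially. \<not> R (x k)"
proof -
  from eventually_not_rat[OF finite_rat_if_finite_real[OF assms]] show ?thesis by (simp add: of_rat_divide)
qed

lemma \<xi>_bounded: "\<bar>\<xi>\<bar> \<le> 1"
  using tendsto_rabs[OF x_tendsto] x_bounded by (intro LIMSEQ_le_const2) auto

lemma poly_close:
  fixes R :: "real poly"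
  assumes "poly R \<xi> = 0"
  shows "\<exists>C\<ge>0. \<forall>k. \<bar>poly R (x k)\<bar> \<le> C / of_int (q (Suc k))"
proof -
  obtain C where C: "C \<ge> 0" "\<And>u v. \<bar>u\<bar> \<le> 1 \<Longrightarrow> \<bar>v\<bar> \<le> 1 \<Longrightarrow> \<bar>poly R u - poly R v\<bar> \<le> C * \<bar>u - v\<bar>"
    using poly_lipschitz[of 1 R] by blast
  have "\<bar>poly R (x k)\<bar> \<le> 2 * C / of_int (q (Suc k))" for k
  proof -
    have "\<bar>poly R (x k)\<bar> \<le> C * \<bar>x k - \<xi>\<bar>" using C(2)[OF x_bounded \<xi>_bounded, of k] assms by simp
    also have "\<dots> \<le> C * (2 / of_int (q (Suc k)))"
      using close[of k] C(1) by (intro mult_left_mono) (simp_all add: abs_minus_commute)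
    finally show ?thesis by (simp add: mult_ac)
  qed
  thus ?thesis using C(1) by (intro exI[of _ "2 * C"]) simp
qed

end

section \<open>Approximation of the value of a rational function over \<open>K\<close>\<close>

locale approximation_over_field = rapid_approximation + number_basis
begin

text \<open>A zero at \<open>\<xi>\<close> would make R(x k) of order \<open>1 / q (Suc k)\<close>,
  whereas its nonzero values are bounded below by a fixed negative power of \<open>q k\<close> up to
  a constant. In particular F has no pole at \<open>\<xi>\<close>.\<close>

lemma transcendental:
  fixes R :: "real poly"
  assumes R: "\<And>i. coeff R i \<in> K" "R \<noteq> 0"
  shows "poly R \<xi> \<noteq> 0"
proof
  assume "poly R \<xi> = 0"
  then obtain C1 where C1: "C1 \<ge> 0" "\<And>k. \<bar>poly R (x k)\<bar> \<le> C1 / of_int (q (Suc k))"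
    using poly_close by blast
  have "coeff 1 i \<in> K" for i using K_0 K_1 by (simp add: one_pCons coeff_pCons split: nat.split)
  then obtain C D where L: "\<And>(p::int) (q::int) g H. 0 \<le> p \<Longrightarrow> p \<le> q \<Longrightarrow> 0 < q \<Longrightarrow>
    poly 1 (of_int p / of_int q) \<noteq> (0::real) \<Longrightarrow>
    degree g \<le> 1 \<Longrightarrow> (\<forall>i. real_of_int \<bar>coeff g i\<bar> \<le> H) \<Longrightarrow>
    poly (of_int_poly g) (poly R (of_int p / of_int q) / poly 1 (of_int p / of_int q)) \<noteq> 0 \<Longrightarrow>
    1 \<le> C * \<bar>poly (of_int_poly g) (poly R (of_int p / of_int q) / poly 1 (of_int p / of_int q))\<bar>
        * H ^ (m - 1) * of_int q ^ D"
    using liouville_inequality[OF R(1), of 1 1] by blast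
  have low: "1 \<le> C * \<bar>poly R (x k)\<bar> * of_int (q k) ^ D" if "poly R (x k) \<noteq> 0" for k
  proof -
    \<comment> \<open>With \<open>[:0, 1:]\<close> for \<open>g\<close> and denominator 1, the
      Liouville inequality bounds R(x k) itself from below.\<close>
    have "\<forall>i. real_of_int \<bar>coeff [:0, 1:] i\<bar> \<le> 1" by (auto simp: coeff_pCons split: nat.split)
    from L[OF p_nonneg p_le q_pos _ _ this, of k] that show ?thesis by (simp add: hom_distribs)
  qed
  have "finite {r. poly R r = 0}" using R(2) by (rule poly_roots_finite)
  from eventually_not_real[OF this] have "\<forall>\<^sub>F k in sequentially. False"
    using growth_strict[of "C * C1" D]
  proof (eventually_elim)
    case (elim k)
    have "C \<ge> 0"
    proof (rule ccontr)
      assume "\<not> C \<ge> 0"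
      hence "C * \<bar>poly R (x k)\<bar> * of_int (q k) ^ D \<le> 0"
        using q_pos[of k] by (intro mult_nonpos_nonneg) auto
      thus False using low[OF elim(1)] by linarith
    qed
    hence "C * \<bar>poly R (x k)\<bar> * of_int (q k) ^ D \<le> C * (C1 / of_int (q (Suc k))) * of_int (q k) ^ D"
      using C1(2) q_pos[of k] by (intro mult_right_mono mult_left_mono) auto
    also have "\<dots> = C * C1 * of_int (q k) ^ D / of_int (q (Suc k))" by simp
    also have "\<dots> < 1" using elim(2) q_pos[of "Suc k"] by simp
    finally show False using low[OF elim(1)] by linarith
  qed
  thus False by simp
qed

context
  fixes P Q :: "real poly"
  assumes deg: "field_degree K = m" and cf: "coefficient_field K (Fract P Q)"
    and PQ: "\<And>i. coeff P i \<in> K" "\<And>i. coeff Q i \<in> K" "Q \<noteq> 0"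
    and nonconst: "\<not> constant_ratfun (Fract P Q)"
begin

abbreviation y :: "nat \<Rightarrow> real" where "y k \<equiv> poly P (x k) / poly Q (x k)"

definition \<eta> :: real where "\<eta> = poly P \<xi> / poly Q \<xi>"

lemma Q\<xi>: "poly Q \<xi> \<noteq> 0"
  using transcendental PQ by blast

lemma eventually_value:
  "\<forall>\<^sub>F k in sequentially. poly Q (x k) \<noteq> 0 \<and> alg_degree (y k) = m"
  using eventually_not_rat[OF finite_exceptional_points[OF deg cf PQ]] by (simp add: of_rat_divide)

lemma y_in_K: "y k \<in> K"
  using PQ subfield_of_int[OF subfield]
  by (intro subfield_divide[OF subfield] poly_in_K) auto

lemma y_algebraic: "algebraic (y k)"
  using K_algebraic(1)[OF y_in_K] .

lemma value_close: "\<exists>C>0. \<forall>\<^sub>F k in sequentially. \<bar>y k - \<eta>\<bar> \<le> C / of_int (q (Suc k))"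
proof -
  \<comment> \<open>\<open>W\<close> vanishes at \<open>\<xi>\<close> and is the numerator in y k -
    \<eta> = W(x k) / (Q(x k) Q(\<xi>)).\<close>
  define W where "W = Polynomial.smult (poly Q \<xi>) P - Polynomial.smult (poly P \<xi>) Q"
  have "poly W \<xi> = 0" by (simp add: W_def)
  then obtain C where C: "C \<ge> 0" "\<And>k. \<bar>poly W (x k)\<bar> \<le> C / of_int (q (Suc k))"
    using poly_close by blast
  define c where "c = \<bar>poly Q \<xi>\<bar> / 2"
  have c: "c > 0" using Q\<xi> by (simp add: c_def)
  have "(\<lambda>k. \<bar>poly Q (x k)\<bar>) \<longlonglongrightarrow> \<bar>poly Q \<xi>\<bar>"
    by (intro tendsto_rabs tendsto_poly x_tendsto)
  hence "\<forall>\<^sub>F k in sequentially. c < \<bar>poly Q (x k)\<bar>"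
    by (rule order_tendstoD) (use Q\<xi> in \<open>simp add: c_def\<close>)
  hence "\<forall>\<^sub>F k in sequentially. \<bar>y k - \<eta>\<bar> \<le> (C / (2 * c\<^sup>2) + 1) / of_int (q (Suc k))"
  proof eventually_elim
    case (elim k)
    hence "poly Q (x k) \<noteq> 0" using c by auto
    hence "y k - \<eta> = poly W (x k) / (poly Q (x k) * poly Q \<xi>)"
      using Q\<xi> by (simp add: \<eta>_def W_def field_simps)
    hence "\<bar>y k - \<eta>\<bar> = \<bar>poly W (x k)\<bar> / (\<bar>poly Q (x k)\<bar> * (2 * c))"
      by (simp add: c_def abs_mult)
    also have "\<dots> \<le> (C / of_int (q (Suc k))) / (c * (2 * c))"
      using C elim c q_pos[of "Suc k"] by (intro frac_le mult_right_mono) auto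
    also have "\<dots> = (C / (2 * c\<^sup>2)) / of_int (q (Suc k))" by (simp add: power2_eq_square mult_ac)
    also have "\<dots> \<le> (C / (2 * c\<^sup>2) + 1) / of_int (q (Suc k))"
      using q_pos[of "Suc k"] by (intro divide_right_mono) auto
    finally show ?case .
  qed
  moreover have "C / (2 * c\<^sup>2) + 1 > 0" using C(1) c by (simp add: add_nonneg_pos)
  ultimately show ?thesis by blast
qed

lemma value_tendsto: "y \<longlonglongrightarrow> \<eta>"
  unfolding \<eta>_def by (intro tendsto_divide tendsto_poly x_tendsto Q\<xi>)

text \<open>A coincidence with \<eta> is a root of \<open>W\<close>, and \<open>W = 0\<close> would
  make F the constant \<eta>.\<close>

lemma value_neq: "\<forall>\<^sub>F k in sequentially. y k \<noteq> \<eta>"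
proof -
  define W where "W = Polynomial.smult (poly Q \<xi>) P - Polynomial.smult (poly P \<xi>) Q"
  have "W \<noteq> 0"
  proof
    assume "W = 0"
    hence "Polynomial.smult (poly Q \<xi>) P = Polynomial.smult (poly P \<xi>) Q" by (simp add: W_def)
    hence "Polynomial.smult (inverse (poly Q \<xi>)) (Polynomial.smult (poly Q \<xi>) P)
        = Polynomial.smult (inverse (poly Q \<xi>)) (Polynomial.smult (poly P \<xi>) Q)" by simp
    hence "P = Polynomial.smult \<eta> Q"
      using Q\<xi> by (simp add: \<eta>_def divide_inverse mult.commute)
    hence "Fract P Q = Fract [:\<eta>:] 1" using PQ(3) by (simp add: eq_fract)
    thus False using nonconst by (auto simp: constant_ratfun_def)
  qed
  hence "finite {r. poly W r = 0}" by (rule poly_roots_finite)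
  from eventually_not_real[OF this] eventually_value show ?thesis
  proof eventually_elim
    case (elim k)
    thus ?case using Q\<xi> by (auto simp: W_def \<eta>_def field_simps)
  qed
qed

lemma value_height: "\<exists>C\<ge>1. \<exists>D. \<forall>\<^sub>F k in sequentially. real_of_int (height (y k)) \<le> C * of_int (q k) ^ D"
proof -
  obtain T where T: "T \<noteq> 0" "degree T \<le> m" "\<And>x. poly Q x \<noteq> 0 \<Longrightarrow> eval2 T x (poly P x / poly Q x) = 0"
    using algebraic_relation_K[OF PQ] by blast
  obtain C D S where fin: "finite S" and S: "\<And>(p::int) (q::int) r \<alpha>. r = of_int p / of_int q \<Longrightarrow> r \<notin> S \<Longrightarrow>
    0 \<le> p \<Longrightarrow> p \<le> q \<Longrightarrow> 0 < q \<Longrightarrow> poly Q r \<noteq> 0 \<Longrightarrow> \<alpha> = poly P r / poly Q r \<Longrightarrow>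
    algebraic \<alpha> \<Longrightarrow> alg_degree \<alpha> = m \<Longrightarrow> real_of_int (height \<alpha>) \<le> C * of_int q ^ D"
    using height_value_le[of T m Q P] T by blast
  have "finite {r. r \<in> S}" using fin by simp
  from eventually_not_real[OF this] eventually_value
  have "\<forall>\<^sub>F k in sequentially. real_of_int (height (y k)) \<le> max C 1 * of_int (q k) ^ D"
  proof eventually_elim
    case (elim k)
    hence "real_of_int (height (y k)) \<le> C * of_int (q k) ^ D"
      using S[OF refl _ p_nonneg p_le q_pos _ refl y_algebraic, of k] by simp
    also have "\<dots> \<le> max C 1 * of_int (q k) ^ D" using q_pos[of k] by (intro mult_right_mono) auto
    finally show ?case .
  qed
  thus ?thesis by (intro exI[of _ "max C 1"]) auto
qed

text \<open>The height of \<open>y k\<close> is at most polynomial in \<open>q k\<close>, while the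
  error is of order \<open>1 / q (Suc k)\<close>, below every power of
  \<open>1 / q k\<close>.\<close>

lemma eventually_good_approximation:
  "\<forall>\<^sub>F k in sequentially. \<bar>\<eta> - y k\<bar> < of_int (height (y k)) powr (- w - 1)"
proof -
  obtain N :: nat where N: "w + 1 \<le> real N" using real_arch_simple by blast
  obtain C1 where C1: "C1 > 0" "\<forall>\<^sub>F k in sequentially. \<bar>y k - \<eta>\<bar> \<le> C1 / of_int (q (Suc k))"
    using value_close by blast
  obtain C2 D where C2: "C2 \<ge> 1" "\<forall>\<^sub>F k in sequentially. real_of_int (height (y k)) \<le> C2 * of_int (q k) ^ D"
    using value_height by blast
  show ?thesis using C1(2) C2(2) growth_strict[of "C1 * C2 ^ N" "D * N"]
  proof eventually_elim
    case (elim k)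
    define h where "h = real_of_int (height (y k))"
    have h: "h \<ge> 1" using height_ge_1[OF y_algebraic, of k] by (simp add: h_def)
    have "C1 * h ^ N \<le> C1 * (C2 * of_int (q k) ^ D) ^ N"
      using elim(2) h C1(1) by (intro mult_left_mono power_mono) (auto simp: h_def)
    also have "\<dots> = C1 * C2 ^ N * of_int (q k) ^ (D * N)"
      by (simp add: power_mult_distrib power_mult)
    also have "\<dots> < of_int (q (Suc k))" by (rule elim(3))
    finally have "C1 / of_int (q (Suc k)) < 1 / h ^ N"
      using h q_pos[of "Suc k"] by (simp add: field_simps)
    also have "1 / h ^ N = h powr (- real N)"
      using h by (simp add: powr_minus powr_realpow divide_inverse)
    also have "\<dots> \<le> h powr (- w - 1)" using h N by (intro powr_mono) auto
    finally show ?case using elim(1) by (simp add: h_def abs_minus_commute)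
  qed
qed

text \<open>The values \<open>y k\<close> may repeat, so infinitude is derived from convergence:
  each element of the set differs from \<eta>, hence the \<open>y k\<close> eventually avoid any
  finite number of them.\<close>

lemma infinite_approximations:
  "infinite {\<alpha> :: real. algebraic \<alpha> \<and> alg_degree \<alpha> = m \<and>
     0 < \<bar>\<eta> - \<alpha>\<bar> \<and> \<bar>\<eta> - \<alpha>\<bar> < of_int (height \<alpha>) powr (- w - 1)}" (is "infinite ?A")
proof
  assume fin: "finite ?A"
  have "\<forall>\<^sub>F k in sequentially. \<forall>\<alpha>\<in>?A. y k \<noteq> \<alpha>"
    unfolding eventually_ball_finite_distrib[OF fin]
  proof
    fix \<alpha> assume "\<alpha> \<in> ?A"
    hence "\<eta> \<noteq> \<alpha>" by auto
    thus "\<forall>\<^sub>F k in sequentially. y k \<noteq> \<alpha>" by (rule tendsto_imp_eventually_ne[OF value_tendsto])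
  qed
  with eventually_good_approximation[of w] eventually_value value_neq
  have "\<forall>\<^sub>F k in sequentially. False"
  proof eventually_elim
    case (elim k)
    have "y k \<in> ?A" using elim(1-3) y_algebraic[of k] by auto
    thus False using elim(4) by blast
  qed
  thus False by simp
qed

text \<open>For \<open>\<gamma>\<close> of degree less than \<open>m\<close> the Liouville inequality separates \<open>\<gamma>\<close> from each \<open>y k\<close>.
  The index \<open>k\<close> is chosen minimal such that \<open>q (Suc k)\<close> exceeds the fixed power of the height of
  \<open>\<gamma>\<close> below which \<open>\<eta>\<close> could not be told from \<open>y k\<close>; then \<open>q k\<close> is still bounded by that power.\<close>

lemma separation:
  assumes n: "n < m"
  shows "\<exists>E M. \<forall>\<gamma>. algebraic \<gamma> \<longrightarrow> alg_degree \<gamma> = n \<longrightarrow> \<bar>\<eta> - \<gamma>\<bar> \<le> 1 \<longrightarrow>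
    1 \<le> E * of_int (height \<gamma>) ^ M * \<bar>\<eta> - \<gamma>\<bar>"
proof -
  define B where "B = \<bar>\<eta>\<bar> + 1"
  obtain C D where L: "\<And>(p::int) (q::int) g H. 0 \<le> p \<Longrightarrow> p \<le> q \<Longrightarrow> 0 < q \<Longrightarrow>
    poly Q (of_int p / of_int q) \<noteq> 0 \<Longrightarrow>
    degree g \<le> n \<Longrightarrow> (\<forall>i. real_of_int \<bar>coeff g i\<bar> \<le> H) \<Longrightarrow>
    poly (of_int_poly g) (poly P (of_int p / of_int q) / poly Q (of_int p / of_int q)) \<noteq> 0 \<Longrightarrow>
    1 \<le> C * \<bar>poly (of_int_poly g) (poly P (of_int p / of_int q) / poly Q (of_int p / of_int q))\<bar>
        * H ^ (m - 1) * of_int q ^ D"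
    using liouville_inequality[OF PQ(1,2), of n] by blast
  have "\<forall>i. \<exists>c\<ge>0. \<forall>u v. \<bar>u\<bar> \<le> B \<longrightarrow> \<bar>v\<bar> \<le> B \<longrightarrow> \<bar>u ^ i - v ^ i\<bar> \<le> c * \<bar>u - v\<bar>"
  proof
    fix i
    show "\<exists>c\<ge>0. \<forall>u v. \<bar>u\<bar> \<le> B \<longrightarrow> \<bar>v\<bar> \<le> B \<longrightarrow> \<bar>u ^ i - v ^ i\<bar> \<le> c * \<bar>u - v\<bar>"
      using poly_lipschitz[of B "monom 1 i"] unfolding poly_monom mult_1 by blast
  qed
  then obtain c where c: "\<And>i. c i \<ge> 0"
    "\<And>i u v. \<bar>u\<bar> \<le> B \<Longrightarrow> \<bar>v\<bar> \<le> B \<Longrightarrow> \<bar>u ^ i - v ^ i\<bar> \<le> c i * \<bar>u - v\<bar>" by metis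
  define S where "S = (\<Sum>i\<le>n. c i)"
  have S0: "S \<ge> 0" using c(1) by (simp add: S_def sum_nonneg)
  define C4 where "C4 = \<bar>C\<bar> * S + 1"
  have C4: "C4 \<ge> 1" using S0 by (simp add: C4_def)
  have near: "\<forall>\<^sub>F k in sequentially. \<bar>y k\<bar> < B"
    using tendsto_rabs[OF value_tendsto] by (rule order_tendstoD) (simp add: B_def)
  obtain C0 where C0: "C0 > 0" "\<forall>\<^sub>F k in sequentially. \<bar>y k - \<eta>\<bar> \<le> C0 / of_int (q (Suc k))"
    using value_close by blast
  define C1 where "C1 = C0 + 1"
  have "\<forall>\<^sub>F k in sequentially. poly Q (x k) \<noteq> 0 \<and> alg_degree (y k) = m \<and> \<bar>y k\<bar> < B \<and>
      \<bar>y k - \<eta>\<bar> \<le> C0 / of_int (q (Suc k)) \<and> real_of_int (q k) ^ (2 * D) \<le> of_int (q (Suc k))"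
    using eventually_value near C0(2) growth[of "2 * D"] by eventually_elim simp
  then obtain k0 where k0: "\<And>k. k \<ge> k0 \<Longrightarrow> poly Q (x k) \<noteq> 0 \<and> alg_degree (y k) = m \<and> \<bar>y k\<bar> < B \<and>
      \<bar>y k - \<eta>\<bar> \<le> C0 / of_int (q (Suc k)) \<and> real_of_int (q k) ^ (2 * D) \<le> of_int (q (Suc k))"
    unfolding eventually_sequentially by blast
  \<comment> \<open>\<open>E\<close> and \<open>M\<close> are what remains when \<open>q k\<close>
    is replaced by \<open>q k0 * z\<^sup>2\<close> in the final estimate, where z = 2 C1 C4 H ^
    m.\<close>
  define E where "E = 2 * C4 * (of_int (q k0) * (2 * C1 * C4)\<^sup>2) ^ D"
  define M where "M = m + 2 * m * D"
  have "1 \<le> E * of_int (height \<gamma>) ^ M * \<bar>\<eta> - \<gamma>\<bar>"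
    if \<gamma>: "algebraic \<gamma>" "alg_degree \<gamma> = n" "\<bar>\<eta> - \<gamma>\<bar> \<le> 1" for \<gamma>
  proof -
    define H where "H = real_of_int (height \<gamma>)"
    have H: "H \<ge> 1" using height_ge_1[OF \<gamma>(1)] by (simp add: H_def)
    define g where "g = int_minpoly \<gamma>"
    have g: "degree g = n" "g \<noteq> 0" "poly (of_int_poly g) \<gamma> = 0"
      using \<gamma> algebraic_int_poly[OF \<gamma>(1)] by (auto simp: g_def alg_degree_def)
    have gH: "real_of_int \<bar>coeff g i\<bar> \<le> H" for i
      using coeff_le_height[OF \<gamma>(1), of i] by (simp add: g_def H_def)
    have \<gamma>B: "\<bar>\<gamma>\<bar> \<le> B" using \<gamma>(3) by (simp add: B_def)
    \<comment> \<open>g(y k) is nonzero because \<open>y k\<close> has degree \<open>m > n\<close>.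
      As g(\<gamma>) = 0, it is bounded by a multiple of
      \<open>H * \<bar>y k - \<gamma>\<bar>\<close>; the Liouville inequality contributes the
      remaining \<open>H ^ (m - 1)\<close>.\<close>
    have sep: "1 \<le> C4 * H ^ m * of_int (q k) ^ D * \<bar>y k - \<gamma>\<bar>" if "k \<ge> k0" for k
    proof -
      note k = k0[OF that]
      have nz: "poly (of_int_poly g) (y k) \<noteq> 0"
      proof
        assume "poly (of_int_poly g) (y k) = 0"
        hence "alg_degree (y k) \<le> n" using algebraic_int_poly(5)[OF y_algebraic g(2)] g(1) by simp
        thus False using k n by simp
      qed
      have "poly (of_int_poly g) (y k) = (\<Sum>i\<le>n. of_int (coeff g i) * (y k ^ i - \<gamma> ^ i))"
        using poly_eq_sum[of "of_int_poly g" n "y k"] poly_eq_sum[of "of_int_poly g" n \<gamma>] g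
        by (simp add: right_diff_distrib sum_subtractf)
      also have "\<bar>\<dots>\<bar> \<le> (\<Sum>i\<le>n. \<bar>of_int (coeff g i) * (y k ^ i - \<gamma> ^ i)\<bar>)" by (rule sum_abs)
      also have "\<dots> \<le> (\<Sum>i\<le>n. H * (c i * \<bar>y k - \<gamma>\<bar>))"
        unfolding abs_mult using gH c(2)[of "y k" \<gamma>] k \<gamma>B H by (intro sum_mono mult_mono) auto
      also have "\<dots> = H * S * \<bar>y k - \<gamma>\<bar>" by (simp add: S_def sum_distrib_left sum_distrib_right mult.assoc)
      finally have up: "\<bar>poly (of_int_poly g) (y k)\<bar> \<le> H * S * \<bar>y k - \<gamma>\<bar>" .
      have "1 \<le> C * \<bar>poly (of_int_poly g) (y k)\<bar> * H ^ (m - 1) * of_int (q k) ^ D"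
        using g(1) gH k nz by (intro L p_nonneg p_le q_pos) auto
      also have "\<dots> \<le> \<bar>C\<bar> * (H * S * \<bar>y k - \<gamma>\<bar>) * H ^ (m - 1) * of_int (q k) ^ D"
        using up H q_pos[of k] by (intro mult_right_mono mult_mono) auto
      also have "\<dots> = \<bar>C\<bar> * S * (H ^ m * of_int (q k) ^ D * \<bar>y k - \<gamma>\<bar>)"
        using m_pos by (simp add: power_eq_if mult_ac)
      also have "\<dots> \<le> C4 * (H ^ m * of_int (q k) ^ D * \<bar>y k - \<gamma>\<bar>)"
        using H q_pos[of k] by (intro mult_right_mono) (auto simp: C4_def)
      finally show ?thesis by (simp add: mult.assoc)
    qed
    \<comment> \<open>Chosen so that the error of \<open>y k\<close>, multiplied by the factor in
      \<open>sep\<close>, is at most 1/2 once \<open>z * q k ^ D \<le> q (Suc k)\<close>.\<close>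
    define z where "z = 2 * C1 * C4 * H ^ m"
    have "1 * 1 \<le> 2 * C1 * C4" using C4 C0(1) by (intro mult_mono) (auto simp: C1_def)
    hence "1 * 1 \<le> 2 * C1 * C4 * H ^ m" using H by (intro mult_mono) auto
    hence z1: "z \<ge> 1" by (simp add: z_def)
    define R where "R k \<longleftrightarrow> k \<ge> k0 \<and> z\<^sup>2 \<le> of_int (q (Suc k))" for k
    have "\<exists>k. R k"
    proof -
      obtain k1 where "\<And>k. k \<ge> k1 \<Longrightarrow> z\<^sup>2 \<le> of_int (q k)"
        using q_large[of "z\<^sup>2"] unfolding eventually_sequentially by blast
      hence "R (max k0 k1)" by (simp add: R_def)
      thus ?thesis ..
    qed
    define k where "k = (LEAST k. R k)"
    have Rk: "R k" unfolding k_def using \<open>\<exists>k. R k\<close> by (rule LeastI_ex)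
    have least: "\<not> R j" if "j < k" for j using that unfolding k_def by (rule not_less_Least)
    have kk0: "k \<ge> k0" and zq: "z\<^sup>2 \<le> of_int (q (Suc k))" using Rk by (simp_all add: R_def)
    \<comment> \<open>For \<open>k > k0\<close> minimality gives \<open>q k < z\<^sup>2\<close>; the
      factor \<open>q k0\<close> covers \<open>k = k0\<close>.\<close>
    have qk: "of_int (q k) \<le> of_int (q k0) * z\<^sup>2"
    proof (cases "k = k0")
      case True
      thus ?thesis using z1 q_pos[of k0] by simp
    next
      case False
      then obtain j where j: "k = Suc j" "j \<ge> k0" using kk0 by (cases k) auto
      have "of_int (q k) \<le> z\<^sup>2" using least[of j] j by (simp add: R_def)
      also have "\<dots> \<le> of_int (q k0) * z\<^sup>2"
        using q_ge_1[of k0] by (simp add: mult_le_cancel_right1)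
      finally show ?thesis .
    qed
    \<comment> \<open>\<open>q (Suc k)\<close> dominates \<open>z\<^sup>2\<close> by the choice of
      \<open>k\<close> and \<open>q k ^ (2 * D)\<close> by the choice of \<open>k0\<close>, hence
      also their geometric mean.\<close>
    have "(z * of_int (q k) ^ D)\<^sup>2 = z\<^sup>2 * of_int (q k) ^ (2 * D)"
      by (simp only: power_mult_distrib power_even_eq)
    also have "\<dots> \<le> of_int (q (Suc k)) * of_int (q (Suc k))"
      using zq k0[OF kk0] q_pos[of "Suc k"] q_pos[of k] by (intro mult_mono) auto
    finally have "(z * of_int (q k) ^ D)\<^sup>2 \<le> (of_int (q (Suc k)))\<^sup>2" by (simp add: power2_eq_square)
    hence zqD: "z * of_int (q k) ^ D \<le> of_int (q (Suc k))"
      by (rule power2_le_imp_le) (use q_pos[of "Suc k"] in simp)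
    define X where "X = C4 * H ^ m * of_int (q k) ^ D"
    have X0: "X \<ge> 0" using C4 H q_pos[of k] by (simp add: X_def)
    have "X * \<bar>y k - \<eta>\<bar> \<le> X * (C1 / of_int (q (Suc k)))"
    proof -
      have "C0 / of_int (q (Suc k)) \<le> C1 / of_int (q (Suc k))"
        using q_pos[of "Suc k"] by (intro divide_right_mono) (auto simp: C1_def)
      thus ?thesis using k0[OF kk0] X0 by (intro mult_left_mono) auto
    qed
    also have "\<dots> = (z * of_int (q k) ^ D) / (2 * of_int (q (Suc k)))"
      by (simp add: X_def z_def)
    also have "\<dots> \<le> 1 / 2" using zqD q_pos[of "Suc k"] by (simp add: field_simps)
    finally have half: "X * \<bar>y k - \<eta>\<bar> \<le> 1 / 2" .
    have "1 \<le> X * \<bar>y k - \<gamma>\<bar>" using sep[OF kk0] by (simp add: X_def)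
    also have "\<dots> \<le> X * (\<bar>y k - \<eta>\<bar> + \<bar>\<eta> - \<gamma>\<bar>)" using X0 by (intro mult_left_mono) auto
    also have "\<dots> \<le> 1 / 2 + X * \<bar>\<eta> - \<gamma>\<bar>" using half by (simp add: distrib_left)
    finally have "1 \<le> 2 * X * \<bar>\<eta> - \<gamma>\<bar>" by simp
    also have "\<dots> \<le> 2 * (C4 * H ^ m * (of_int (q k0) * z\<^sup>2) ^ D) * \<bar>\<eta> - \<gamma>\<bar>"
      unfolding X_def using qk C4 H q_pos[of k]
      by (intro mult_right_mono mult_left_mono power_mono) auto
    also have "\<dots> = E * H ^ M * \<bar>\<eta> - \<gamma>\<bar>"
    proof -
      define A where "A = 2 * C1 * C4"
      have "((H ^ m)\<^sup>2) ^ D = H ^ (2 * m * D)" by (simp add: mult_ac flip: power_mult)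
      hence "(z\<^sup>2) ^ D = (A\<^sup>2) ^ D * H ^ (2 * m * D)"
        by (simp only: z_def A_def[symmetric] power_mult_distrib)
      thus ?thesis
        unfolding E_def M_def A_def[symmetric] by (simp only: power_mult_distrib power_add mult_ac)
    qed
    finally show ?thesis by (simp add: H_def)
  qed
  thus ?thesis by blast
qed

lemma U_number_value: "U_number m (poly P \<xi> / poly Q \<xi>)"
  unfolding U_number_def \<eta>_def[symmetric]
proof (intro conjI allI impI)
  show "1 \<le> m" using m_pos by simp
  show "omega_star m \<eta> = \<infinity>"
  proof (rule ccontr)
    assume "omega_star m \<eta> \<noteq> \<infinity>"
    hence "omega_star m \<eta> < \<infinity>" by (simp add: less_top)
    then obtain N :: nat where N: "omega_star m \<eta> < of_nat N" using ennreal_Ex_less_of_nat by auto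
    have "ennreal (real (Suc N)) \<le> omega_star m \<eta>"
      unfolding omega_star_def using infinite_approximations by (intro Sup_upper imageI) simp
    also have "\<dots> < of_nat N" by (rule N)
    finally show False by (simp add: ennreal_of_nat_eq_real_of_nat)
  qed
  fix n assume n: "1 \<le> n \<and> n < m"
  then obtain E M where sep: "\<And>\<gamma>. algebraic \<gamma> \<Longrightarrow> alg_degree \<gamma> = n \<Longrightarrow> \<bar>\<eta> - \<gamma>\<bar> \<le> 1 \<Longrightarrow>
      1 \<le> E * of_int (height \<gamma>) ^ M * \<bar>\<eta> - \<gamma>\<bar>" using separation by blast
  have "w \<le> real M" if w: "w > 0" and inf: "infinite {\<alpha> :: real. algebraic \<alpha> \<and> alg_degree \<alpha> = n \<and>
       0 < \<bar>\<eta> - \<alpha>\<bar> \<and> \<bar>\<eta> - \<alpha>\<bar> < of_int (height \<alpha>) powr (- w - 1)}" (is "infinite ?A") for w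
  proof (rule ccontr)
    assume wM: "\<not> w \<le> real M"
    \<comment> \<open>An exponent above \<open>M\<close> makes the distance at most
      \<open>1 / h ^ Suc M\<close>; against the lower bound from \<open>separation\<close>, of order
      \<open>1 / h ^ M\<close>, this confines the height.\<close>
    have "?A \<subseteq> {\<alpha>. algebraic \<alpha> \<and> alg_degree \<alpha> = n \<and> real_of_int (height \<alpha>) \<le> \<bar>E\<bar>}"
    proof
      fix \<gamma> assume \<gamma>: "\<gamma> \<in> ?A"
      define h where "h = real_of_int (height \<gamma>)"
      have h: "h \<ge> 1" using height_ge_1 \<gamma> by (simp add: h_def)
      have "\<bar>\<eta> - \<gamma>\<bar> \<le> h powr (- w - 1)" using \<gamma> by (simp add: h_def)
      also have "\<dots> \<le> h powr (- real (Suc M))" using h wM by (intro powr_mono) auto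
      also have "\<dots> = 1 / h ^ Suc M" using h by (simp only: powr_minus powr_realpow divide_inverse)
      finally have close: "\<bar>\<eta> - \<gamma>\<bar> \<le> 1 / h ^ Suc M" .
      also have "\<dots> \<le> 1" using h one_le_power[of h "Suc M"] by (simp add: field_simps)
      finally have "1 \<le> E * h ^ M * \<bar>\<eta> - \<gamma>\<bar>" using sep \<gamma> by (simp add: h_def)
      also have "\<dots> \<le> \<bar>E\<bar> * h ^ M * (1 / h ^ Suc M)"
        using close h by (intro mult_mono) auto
      also have "\<dots> = \<bar>E\<bar> / h" using h by simp
      finally have "h \<le> \<bar>E\<bar>" using h by (simp add: field_simps)
      thus "\<gamma> \<in> {\<alpha>. algebraic \<alpha> \<and> alg_degree \<alpha> = n \<and> real_of_int (height \<alpha>) \<le> \<bar>E\<bar>}"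
        using \<gamma> by (simp add: h_def)
    qed
    thus False using inf finite_bounded_height finite_subset by blast
  qed
  hence "omega_star n \<eta> \<le> ennreal (real M)"
    unfolding omega_star_def by (intro Sup_least) (auto intro: ennreal_leI)
  thus "omega_star n \<eta> < \<infinity>" using le_less_trans[OF _ ennreal_less_top] by simp
qed

end

end

section \<open>Rational bases of number fields\<close>

lemma number_basis_exists:
  assumes "number_field K" "field_degree K = m"
  shows "\<exists>b. number_basis m b K"
proof -
  interpret vector_space rat_scale by (rule vector_space_rat_scale)
  obtain B0 where B0: "finite B0" "span B0 = K" and K: "is_subfield K"
    using assms(1) unfolding number_field_def by blast
  obtain B where B: "B \<subseteq> K" "independent B" "K \<subseteq> span B" "card B = dim K" by (rule basis_exists)
  have "B \<subseteq> span B0" using B(1) B0(2) by simp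
  hence fin: "finite B" using independent_span_bound[OF B0(1) B(2)] by blast
  have "span B \<subseteq> K" using B(1) B0(2) subspace_span[of B0] by (intro span_minimal) simp_all
  hence spanB: "span B = K" using B(3) by blast
  have "card B = m" using B(4) assms(2) by (simp add: field_degree_def)
  then obtain b where b: "bij_betw b {..<m} B"
    using ex_bij_betw_nat_finite[OF fin] by (auto simp: atLeast0LessThan)
  have sum_b: "(\<Sum>v\<in>B. rat_scale (u v) v) = (\<Sum>i<m. of_rat (u (b i)) * b i)" for u
    using sum.reindex_bij_betw[OF b, of "\<lambda>v. rat_scale (u v) v"] by (simp add: rat_scale_def)
  have inv: "the_inv_into {..<m} b (b i) = i" if "i < m" for i
    using b that by (intro the_inv_into_f_f) (auto simp: bij_betw_def)
  have "number_basis m b K"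
  proof
    fix c :: "nat \<Rightarrow> rat" and i
    assume c: "(\<Sum>i<m. of_rat (c i) * b i) = 0" and i: "i < m"
    define u where "u = (\<lambda>v. c (the_inv_into {..<m} b v))"
    have "(\<Sum>v\<in>B. rat_scale (u v) v) = 0"
      unfolding sum_b using c inv by (simp add: u_def)
    moreover have "b i \<in> B" using b i by (auto simp: bij_betw_def)
    ultimately have "u (b i) = 0" by (rule independentD[OF B(2) fin order.refl])
    thus "c i = 0" using inv[OF i] by (simp add: u_def)
  next
    fix z
    show "z \<in> K \<longleftrightarrow> (\<exists>c. z = (\<Sum>i<m. of_rat (c i) * b i))"
    proof
      assume "z \<in> K"
      hence "z \<in> range (\<lambda>u. \<Sum>v\<in>B. rat_scale (u v) v)" using spanB span_finite[OF fin] by simp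
      then obtain u where "z = (\<Sum>v\<in>B. rat_scale (u v) v)" by (rule imageE)
      hence "z = (\<Sum>i<m. of_rat ((\<lambda>i. u (b i)) i) * b i)" by (simp add: sum_b)
      thus "\<exists>c. z = (\<Sum>i<m. of_rat (c i) * b i)" by (intro exI[of _ "\<lambda>i. u (b i)"])
    next
      assume "\<exists>c. z = (\<Sum>i<m. of_rat (c i) * b i)"
      then obtain c where "z = (\<Sum>i<m. rat_scale (c i) (b i))" by (auto simp: rat_scale_def)
      moreover have "b i \<in> span B" if "i < m" for i
        using b that by (intro span_base) (auto simp: bij_betw_def)
      hence "(\<Sum>i<m. rat_scale (c i) (b i)) \<in> span B" by (intro span_sum span_scale) simp
      ultimately show "z \<in> K" by (simp only: spanB)
    qed
  qed (rule K)
  thus ?thesis by (rule exI[of _ b])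
qed

subsection \<open>Lacunary series\<close>

text \<open>The exponents are reindexed from 0. \<open>ratio\<close> makes \<open>q (Suc k)\<close>
  outgrow every power of \<open>q k\<close>; \<open>gap\<close> gives the estimates that hold for
  all \<open>k\<close>.\<close>

locale lacunary_series =
  fixes a :: int and u :: "nat \<Rightarrow> nat" and \<xi> :: real
  assumes a: "a \<ge> 2" and u0: "u 0 > 0" and gap: "u (Suc k) \<ge> 2 * u k + 2"
    and series: "(\<lambda>n. 1 / of_int a ^ u n) sums \<xi>"
    and ratio: "filterlim (\<lambda>n. real (u (Suc n)) / real (u n)) at_top sequentially"
begin

definition q :: "nat \<Rightarrow> int" where "q k = a ^ u k"
definition p :: "nat \<Rightarrow> int" where "p k = (\<Sum>i\<le>k. a ^ (u k - u i))"

lemma strict_mono_u: "strict_mono u"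
  unfolding strict_mono_Suc_iff
proof
  fix k
  show "u k < u (Suc k)" using gap[of k] by linarith
qed

lemma u_add: "u (k + i) \<ge> u k + i"
proof (induction i)
  case (Suc i)
  thus ?case using gap[of "k + i"] by simp
qed simp

lemma u_ge: "u k \<ge> Suc k"
  using u_add[of 0 k] u0 by simp

lemma q_pos: "q k > 0"
  using a by (simp add: q_def)

lemma ratio_eq: "of_int (p k) / of_int (q k) = (\<Sum>i\<le>k. 1 / of_int a ^ u i :: 'a::field_char_0)"
proof -
  have "(of_int (p k) / of_int (q k) :: 'a) = (\<Sum>i\<le>k. of_int a ^ (u k - u i) / of_int a ^ u k)"
    by (simp add: p_def q_def sum_divide_distrib)
  also have "\<dots> = (\<Sum>i\<le>k. 1 / of_int a ^ u i)"
  proof (intro sum.cong refl)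
    fix i assume "i \<in> {..k}"
    hence "u i \<le> u k" using strict_mono_u by (simp add: strict_mono_less_eq)
    hence "(of_int a :: 'a) ^ u k = of_int a ^ (u k - u i) * of_int a ^ u i" by (simp flip: power_add)
    thus "(of_int a ^ (u k - u i) / of_int a ^ u k :: 'a) = 1 / of_int a ^ u i" using a by simp
  qed
  finally show ?thesis .
qed

lemma power_u_ge: "(2::real) ^ i * of_int a ^ u k \<le> of_int a ^ u (k + i)"
proof -
  have "(2::real) ^ i * of_int a ^ u k \<le> of_int a ^ i * of_int a ^ u k"
    using a by (intro mult_right_mono power_mono) auto
  also have "\<dots> \<le> of_int a ^ u (k + i)"
    unfolding power_add[symmetric] using a u_add[of k i] by (intro power_increasing) auto
  finally show ?thesis .
qed

lemma p_nonneg: "p k \<ge> 0"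
  using a by (auto simp: p_def intro: sum_nonneg)

lemma p_le: "p k \<le> q k"
proof -
  \<comment> \<open>The slack \<open>(1 / 2) ^ Suc k\<close> makes the induction work: by
    \<open>u_ge\<close> the next term is at most half of it.\<close>
  have "(\<Sum>i\<le>k. 1 / of_int a ^ u i :: real) \<le> 1 - (1 / 2) ^ Suc k"
  proof (induction k)
    case 0
    have "a ^ 1 \<le> a ^ u 0" using a u0 by (intro power_increasing) auto
    hence "2 \<le> a ^ u 0" using a by simp
    hence "real_of_int 2 \<le> of_int (a ^ u 0)" by (simp only: of_int_le_iff)
    thus ?case by (simp add: field_simps)
  next
    case (Suc k)
    have "(2::real) ^ Suc (Suc k) \<le> of_int a ^ Suc (Suc k)" using a by (intro power_mono) auto
    also have "\<dots> \<le> of_int a ^ u (Suc k)" using a u_ge[of "Suc k"] by (intro power_increasing) auto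
    finally have "1 / of_int a ^ u (Suc k) \<le> 1 / (2::real) ^ Suc (Suc k)" using a by (intro divide_left_mono) auto
    thus ?case using Suc by (simp add: power_one_over)
  qed
  hence "(\<Sum>i\<le>k. 1 / of_int a ^ u i :: real) \<le> 1" by (rule order.trans) simp
  hence "real_of_int (p k) / of_int (q k) \<le> 1" by (simp only: ratio_eq)
  hence "real_of_int (p k) \<le> of_int (q k)" using q_pos[of k] by simp
  thus ?thesis by simp
qed

lemma close: "\<bar>\<xi> - of_int (p k) / of_int (q k)\<bar> \<le> 2 / of_int (q (Suc k))"
proof -
  let ?t = "\<lambda>n. 1 / real_of_int a ^ u n"
  have "(\<lambda>i. ?t (i + Suc k)) sums (\<xi> - (\<Sum>i<Suc k. ?t i))"
    using series by (rule sums_split_initial_segment)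
  hence tail: "(\<lambda>i. ?t (i + Suc k)) sums (\<xi> - of_int (p k) / of_int (q k))"
    by (simp only: ratio_eq lessThan_Suc_atMost)
  \<comment> \<open>The exponents increase by at least 1 and \<open>a \<ge> 2\<close>, so a
    geometric series of ratio 1/2 dominates the tail; its sum is the 2 in the claim.\<close>
  have geo: "(\<lambda>i. ?t (Suc k) * (1 / 2) ^ i) sums (?t (Suc k) * 2)"
    using sums_mult[OF geometric_sums[of "1 / 2 :: real"], of "?t (Suc k)"] by simp
  have "?t (i + Suc k) \<le> ?t (Suc k) * (1 / 2) ^ i" for i
  proof -
    have "?t (Suc k) * (1 / 2) ^ i = 1 / (2 ^ i * of_int a ^ u (Suc k))"
      by (simp add: power_one_over mult.commute)
    moreover have "?t (i + Suc k) \<le> 1 / (2 ^ i * of_int a ^ u (Suc k))"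
      using power_u_ge[of i "Suc k"] a by (intro divide_left_mono) (auto simp: add.commute)
    ultimately show ?thesis by simp
  qed
  hence "\<xi> - of_int (p k) / of_int (q k) \<le> ?t (Suc k) * 2"
    by (rule sums_le[OF _ tail geo])
  moreover have "\<xi> - of_int (p k) / of_int (q k) \<ge> 0"
    by (rule sums_le[OF _ sums_zero tail]) (use a in simp)
  ultimately show ?thesis by (simp add: q_def)
qed

lemma strict_mono_ratio: "strict_mono (\<lambda>k. of_int (p k) / of_int (q k) :: 'a::linordered_field)"
  using a unfolding ratio_eq strict_mono_Suc_iff by simp

lemma q_large: "\<forall>\<^sub>F k in sequentially. X \<le> real_of_int (q k)"
proof -
  obtain N :: nat where N: "X \<le> real N" using real_arch_simple by blast
  have "X \<le> real_of_int (q k)" if "k \<ge> N" for k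
  proof -
    have "real k \<le> real (u k)" using u_ge[of k] by simp
    also have "\<dots> \<le> 2 ^ u k" using of_nat_mono[OF less_imp_le[OF less_exp[of "u k"]], where 'a=real] by simp
    also have "\<dots> \<le> of_int a ^ u k" using a by (intro power_mono) auto
    finally show ?thesis using N that by (simp add: q_def)
  qed
  thus ?thesis unfolding eventually_sequentially by blast
qed

lemma growth: "\<forall>\<^sub>F k in sequentially. real_of_int (q k) ^ S \<le> of_int (q (Suc k))"
proof -
  have "\<forall>\<^sub>F k in sequentially. real S \<le> real (u (Suc k)) / real (u k)"
    using ratio unfolding filterlim_at_top by blast
  thus ?thesis
  proof eventually_elim
    case (elim k)
    have "u k > 0" using u_ge[of k] by simp
    hence "real (u k * S) \<le> real (u (Suc k))" using elim by (simp add: field_simps)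
    hence "u k * S \<le> u (Suc k)" by (simp only: of_nat_le_iff)
    hence "real_of_int a ^ (u k * S) \<le> of_int a ^ u (Suc k)" using a by (intro power_increasing) auto
    thus ?case by (simp add: q_def power_mult)
  qed
qed

sublocale rapid_approximation \<xi> p q
proof
  show "inj (\<lambda>k. of_int (p k) / of_int (q k) :: rat)"
    by (rule strict_mono_imp_inj_on[OF strict_mono_ratio])
qed (fact q_pos p_nonneg p_le close growth q_large)+

text \<open>Modulo \<open>a\<close> only the last summand \<open>a ^ 0\<close> of \<open>p k\<close>
  survives. Reducedness makes the height of the fraction equal to \<open>q k\<close>.\<close>

lemma coprime_p_q: "coprime (p k) (q k)"
proof -
  have "coprime (p k) a"
  proof (rule coprimeI)
    fix d assume d: "d dvd p k" "d dvd a"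
    have "p k = (\<Sum>i<k. a ^ (u k - u i)) + 1"
      by (simp add: p_def flip: lessThan_Suc_atMost)
    moreover have "d dvd (\<Sum>i<k. a ^ (u k - u i))"
    proof (rule dvd_sum)
      fix i assume "i \<in> {..<k}"
      hence "u k - u i > 0" using strict_mono_u by (simp add: strict_mono_less)
      thus "d dvd a ^ (u k - u i)" using d(2) dvd_trans[OF _ dvd_power[of "u k - u i" a]] by simp
    qed
    ultimately show "is_unit d" using d(1) by (simp add: dvd_add_right_iff)
  qed
  thus ?thesis by (simp add: q_def)
qed

lemma height_x: "height (of_int (p k) / of_int (q k)) = q k"
  using height_rational[OF coprime_p_q q_pos, of k] p_nonneg[of k] p_le[of k] by simp

lemma in_liouville_class:
  assumes "liouville_number \<xi>"
  shows "\<xi> \<in> \<L>"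
proof -
  \<comment> \<open>Subtracting 2 makes \<open>q k powr (- \<omega> k)\<close> equal to
    \<open>a ^ 2 / q (Suc k)\<close>, strictly above the error bound \<open>2 / q (Suc k)\<close>;
    \<open>gap\<close> keeps \<open>\<omega> k\<close> positive.\<close>
  define \<omega> where "\<omega> k = (real (u (Suc k)) - 2) / real (u k)" for k
  define r :: "nat \<Rightarrow> rat" where "r k = of_int (p k) / of_int (q k)" for k
  have u_pos: "real (u k) > 0" for k using u_ge[of k] by simp
  have r: "of_rat (r k) = x k" for k by (simp add: r_def of_rat_divide)
  have powr: "of_int (q k) powr (c / real (u k)) = of_int a powr c" for k c
    using a u_pos[of k] by (simp add: q_def powr_powr flip: powr_realpow)
  have "\<omega> k > 0" for k using gap[of k] u_pos[of k] by (simp add: \<omega>_def)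
  moreover have "filterlim \<omega> at_top sequentially"
  proof (rule filterlim_at_top_mono)
    show "filterlim (\<lambda>n. - 2 + real (u (Suc n)) / real (u n)) at_top sequentially"
      by (rule filterlim_tendsto_add_at_top[OF tendsto_const ratio])
    have "2 / real (u n) \<le> 2" for n using u_ge[of n] by (simp add: field_simps)
    hence "- 2 + real (u (Suc n)) / real (u n) \<le> \<omega> n" for n
      unfolding \<omega>_def diff_divide_distrib by (smt (verit))
    thus "\<forall>\<^sub>F n in sequentially. - 2 + real (u (Suc n)) / real (u n) \<le> \<omega> n" by simp
  qed
  moreover have "infinite (range r)"
    using inj unfolding r_def by (rule range_inj_infinite)
  moreover have "\<bar>\<xi> - of_rat (r k)\<bar> < of_int (height (of_rat (r k))) powr (- \<omega> k)" for k
  proof -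
    have "\<bar>\<xi> - x k\<bar> \<le> 2 / of_int (q (Suc k))" by (rule close)
    also have "\<dots> < of_int a ^ 2 / of_int (q (Suc k))"
    proof (intro divide_strict_right_mono)
      have "real_of_int 2 ^ 2 \<le> of_int a ^ 2" using a by (intro power_mono) auto
      thus "2 < real_of_int a ^ 2" by simp
    qed (use q_pos[of "Suc k"] in simp)
    also have "\<dots> = of_int a powr (2 - real (u (Suc k)))"
      using a by (simp add: q_def powr_diff powr_realpow)
    also have "\<dots> = of_int (q k) powr (- \<omega> k)"
      using powr[of k "2 - real (u (Suc k))"] by (simp add: \<omega>_def minus_divide_left)
    finally show ?thesis by (simp add: r height_x)
  qed
  moreover have "of_int (height (of_rat (r (Suc k)))) \<le>
      real_of_int (height (of_rat (r k))) powr (2 * \<omega> k)" for k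
  proof -
    \<comment> \<open>From 4 on, doubling makes up for the subtracted 2, so 2 serves as the constant
      \<open>C\<close>.\<close>
    have "real (u (Suc k)) \<ge> 4" using gap[of k] u_ge[of k] by simp
    hence "of_int a powr real (u (Suc k)) \<le> of_int a powr (2 * (real (u (Suc k)) - 2))"
      using a by (intro powr_mono) auto
    also have "\<dots> = of_int (q k) powr (2 * \<omega> k)"
      using powr[of k "2 * (real (u (Suc k)) - 2)"] by (simp add: \<omega>_def)
    finally show ?thesis using a by (simp add: r height_x powr_realpow) (simp add: q_def)
  qed
  ultimately show ?thesis
    unfolding liouville_class_def using assms
    by (intro CollectI conjI exI[of _ \<omega>] exI[of _ r] exI[of _ 2]) auto
qed

text \<open>\<open>ratfun_eval\<close> uses the reduced fraction, whereas \<open>P\<close> and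
  \<open>Q\<close> over \<open>K\<close> may share a factor; both give the same value because
  \<open>\<xi>\<close> is transcendental over \<open>K\<close>, so that Q(\<xi>) is nonzero.\<close>

lemma U_number_ratfun:
  assumes K: "number_field K" "field_degree K = m"
    and F: "coefficient_field K F" "\<not> constant_ratfun F"
  shows "U_number m (ratfun_eval F \<xi>)"
proof -
  obtain b where "number_basis m b K" using number_basis_exists[OF K] by blast
  then interpret number_basis m b K .
  interpret approximation_over_field \<xi> p q m b K ..
  obtain P Q where PQ: "Q \<noteq> 0" "set (coeffs P) \<subseteq> K" "set (coeffs Q) \<subseteq> K" "F = Fract P Q"
    using F(1) unfolding coefficient_field_def ratfun_over_def by blast
  have "coeff R i \<in> K" if "set (coeffs R) \<subseteq> K" for R :: "real poly" and i
    using that K_0 by (cases "i \<le> degree R \<and> R \<noteq> 0") (auto simp: coeff_in_coeffs subset_iff coeff_eq_0)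
  hence coeffs: "\<And>i. coeff P i \<in> K" "\<And>i. coeff Q i \<in> K" using PQ(2,3) by simp_all
  have "U_number m (poly P \<xi> / poly Q \<xi>)"
    using F unfolding PQ(4) by (intro U_number_value[OF K(2) _ coeffs PQ(1)])
  moreover have "poly Q \<xi> \<noteq> 0" using transcendental[OF coeffs(2) PQ(1)] .
  ultimately show ?thesis unfolding PQ(4) by (simp add: ratfun_eval_Fract)
qed

end

theorem corollary1:
  fixes a :: int and v :: "nat \<Rightarrow> nat" and \<xi> :: real
  assumes "a \<ge> 2"
    and "\<forall>n\<ge>1. v n > 0"
    and "\<forall>n\<ge>1. v (n + 1) \<ge> 2 * v n + 2"
    and "liouville_number \<xi>"
    and "(\<lambda>n. 1 / of_int a ^ v (n + 1)) sums \<xi>"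
    and "filterlim (\<lambda>n. real (v (n + 1)) / real (v n)) at_top sequentially"
  shows "\<xi> \<in> \<L> \<and>
    (\<forall>m K F. number_field K \<and> field_degree K = m \<and> coefficient_field K F \<and> \<not> constant_ratfun F
       \<longrightarrow> U_number m (ratfun_eval F \<xi>))"
proof -
  interpret lacunary_series a "\<lambda>n. v (n + 1)" \<xi>
  proof
    show "filterlim (\<lambda>n. real (v (Suc n + 1)) / real (v (n + 1))) at_top sequentially"
      using filterlim_compose[OF assms(6) filterlim_Suc] by simp
  qed (use assms in auto)
  show ?thesis using in_liouville_class[OF assms(4)] U_number_ratfun by blast
qed

end
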